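(* As inputs for Algorithm 2 (described in the context) let $\varepsilon, \delta > 0$ and let the spectrahedron $C=\{x\in\mathbb{R}^n \mid \mathcal{A}(x)\succcurlyeq 0\}$ defined by the matrix $\mathcal{A}(x)$ be unbounded, closed, convex, line-free and with nonempty interior. Then Algorithm 2 works correctly, i.e. if it terminates, it returns (a $V$-representation of) an $(\varepsilon,\delta)$-approximation of $C$.
   Context: Notation. $\|\cdot\|$ is the Euclidean norm, $\|\cdot\|_1$ the $\ell_1$-norm, $B_r(c)$ the Euclidean ball of radius $r$ centered at $c$, $0^+C$ the recession cone, $\operatorname{ext}$ the set of extreme points. A set is line-free if its recession cone is pointed. A polyhedron is a set $\operatorname{conv} V + \operatorname{cone} D$ with $V, D$ finite; $(V,D)$ is a $V$-representation; $\operatorname{vert} P$ is the set of vertices of $P$. For nonempty sets, $e[C_1,C_2] = \sup_{c_1 \in C_1} \inf_{c_2 \in C_2} \|c_1-c_2\|$ and $d_{\mathsf H}(C_1,C_2) = \max\{e[C_1,C_2], e[C_2,C_1]\}$. A polyhedron $P$ is an $\varepsilon$-approximation of a convex set $C$ if $d_{\mathsf H}(P,C)\le\varepsilon$. For nonempty closed convex cones, $\bar d_{\mathsf H}(K_1,K_2) = d_{\mathsf H}(K_1\cap B_1(0), K_2 \cap B_1(0))$. A line-free polyhedron $P$ is an $(\varepsilon,\delta)$-approximation of a nonempty closed convex line-free set $C$ if (i) $e[\operatorname{vert} P, C] \leq \varepsilon$, (ii) $\bar d_{\mathsf H}(0^+P, 0^+C) \leq \delta$, (iii) $P \supseteq C$.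 For symmetric matrices $A_0,\dots,A_n$ of the same size, $\bar{\mathcal{A}}(x)=\sum_{i=1}^n x_iA_i$ and $\mathcal{A}(x)=\bar{\mathcal{A}}(x)+A_0$; $\succcurlyeq 0$ means positive semidefinite; $A\cdot X$ is the trace of $AX$; $I$ is the identity matrix. A spectrahedron is a set $\{x\in\mathbb{R}^n\mid\mathcal{A}(x)\succcurlyeq0\}$; its recession cone is $\{x \mid \bar{\mathcal{A}}(x)\succcurlyeq 0\}$. Subproblems for a spectrahedron given by $\mathcal A$: (P$_1(w)$): $\max w^{\mathsf T}x$ s.t. $\mathcal A(x)\succcurlyeq 0$. (P$_2(v,d)$): $\min t$ s.t. $\mathcal A(x)\succcurlyeq 0$, $x-v-td=0$ (variables $x,t$). (D$_2(v,d)$): $\max -\mathcal A(v)\cdot U$ s.t. $A_i\cdot U=w_i$ ($i=1,\dots,n$), $d^{\mathsf T}w=1$, $U\succcurlyeq0$ (variables $U,w$). Algorithm 1 (cutting scheme). Input: matrix $\mathcal A(x)$ representing a compact spectrahedron $C$ with nonempty interior, error tolerance $\varepsilon$. Output: $V$-representation of a polyhedral $\varepsilon$-approximation $P$ of $C$. Let $e$ be the all-ones vector and $e_i$ the $i$-th unit vector. Compute solutions $x_w^*$ of (P$_1(w)$) for $w\in\{-e,e_1,\dots,e_n\}$; set $P=\{x \mid w^{\mathsf T}x\le w^{\mathsf T}x_w^*\ \forall w\in\{-e,e_1,\dots,e_n\}\}$; set $c=\frac{1}{n+1}\sum_w x_w^*$ (described in the algorithm as an interior point of $C$); set $\kappa=+\infty$.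 While $\kappa>\varepsilon$: compute $\operatorname{vert}P$; for every $v\in\operatorname{vert}P$ set $d=c-v$ and compute solutions $(x_v^*,t_v^* )$ and $(U_v^*,w_v^* )$ to (P$_2(v,d)$) and (D$_2(v,d)$); let $\bar v\in\operatorname{argmax}\{t_v^*\|c-v\| \mid v\in\operatorname{vert}P\}$; replace $P$ by $P\cap\{x\mid w_{\bar v}^{*\mathsf T}x\ge w_{\bar v}^{*\mathsf T}\bar v+t_{\bar v}^*\}$; set $\kappa=t_{\bar v}^*\|c-\bar v\|$. After the loop, compute and return $\operatorname{vert}P$. Algorithm 2. Input: matrix $\mathcal A(x)$ representing an unbounded closed and line-free spectrahedron $C$ with nonempty interior; error tolerances $\varepsilon$ and $\delta$. Output: $V$-representation of an $(\varepsilon,\delta)$-approximation $P$ of $C$. 1. $w \leftarrow (-A_1\cdot I,\dots,-A_n\cdot I)^{\mathsf T}/\|(-A_1\cdot I,\dots,-A_n\cdot I)^{\mathsf T}\|$. 2. $M\leftarrow 0^+C\cap\{x\in\mathbb{R}^n\mid w^{\mathsf T}x=-(1+\delta)\}$. 3. Compute a $\delta/2$-approximation $\overline M$ of $M$ according to Algorithm 1 (with the affine hull of $M$ treated as the ambient space, since $M$ is not full-dimensional). 4. $\overline M\leftarrow\overline M+\{x\in\mathbb{R}^n\mid\|x\|_1\le\delta/2\}$. 5. $K\leftarrow\operatorname{cone}\operatorname{vert}\overline M$. 6. $\overline C\leftarrow C\cap\{x\in\mathbb{R}^n\mid w^{\mathsf T}x\ge\min\{w^{\mathsf T}y\mid y\in\operatorname{conv}\operatorname{ext}(C+K)\}-\varepsilon\}$.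 7. Compute an $\varepsilon$-approximation $\overline P$ of $\overline C$ according to Algorithm 1. 8. $P\leftarrow\overline P+K$. 9. Return a $V$-representation of $P$. *)

theory Defs
  imports "HOL-Analysis.Analysis"
begin

subsection \<open>Convex sets and distances\<close>

definition recession_cone :: "'a::real_vector set \<Rightarrow> 'a set" where
  "recession_cone C = {d. \<forall>x\<in>C. \<forall>t\<ge>0. x + t *\<^sub>R d \<in> C}"

definition line_free :: "'a::real_vector set \<Rightarrow> bool" where
  "line_free C \<longleftrightarrow> recession_cone C \<inter> uminus ` recession_cone C = {0}"

text \<open>The vertices of a polyhedron are exactly its extreme points, so this set serves both
  as \<open>ext\<close> and as \<open>vert\<close>.\<close>
definition ext :: "'a::real_vector set \<Rightarrow> 'a set" where
  "ext C = {x. x extreme_point_of C}"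

definition V_representation :: "'a::real_vector set \<Rightarrow> 'a set \<Rightarrow> 'a set \<Rightarrow> bool" where
  "V_representation V D P \<longleftrightarrow>
     finite V \<and> finite D \<and> P = convex hull V + convex_cone hull D"

text \<open>Extended-real valued, because both quantities may be infinite for unbounded sets.\<close>
definition excess :: "'a::real_normed_vector set \<Rightarrow> 'a set \<Rightarrow> ereal" where
  "excess C1 C2 = (SUP x\<in>C1. INF y\<in>C2. ereal (norm (x - y)))"

definition hausdorff_dist :: "'a::real_normed_vector set \<Rightarrow> 'a set \<Rightarrow> ereal" where
  "hausdorff_dist C1 C2 = max (excess C1 C2) (excess C2 C1)"

definition cone_dist :: "'a::real_normed_vector set \<Rightarrow> 'a set \<Rightarrow> ereal" where
  "cone_dist K1 K2 = hausdorff_dist (K1 \<inter> cball 0 1) (K2 \<inter> cball 0 1)"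

definition eps_delta_approx ::
    "real \<Rightarrow> real \<Rightarrow> 'a::real_normed_vector set \<Rightarrow> 'a set \<Rightarrow> bool" where
  "eps_delta_approx \<epsilon> \<delta> P C \<longleftrightarrow>
     (\<exists>V D. V_representation V D P) \<and> line_free P \<and>
     excess (ext P) C \<le> ereal \<epsilon> \<and>
     cone_dist (recession_cone P) (recession_cone C) \<le> ereal \<delta> \<and>
     C \<subseteq> P"


subsection \<open>Spectrahedra\<close>

definition psd :: "real^'m^'m \<Rightarrow> bool" where
  "psd X \<longleftrightarrow> transpose X = X \<and> (\<forall>v. 0 \<le> v \<bullet> (X *v v))"

definition mat_inner :: "real^'m^'m \<Rightarrow> real^'m^'m \<Rightarrow> real" where
  "mat_inner X Y = trace (X ** Y)"

definition lin_pencil :: "('n::finite \<Rightarrow> real^'m^'m) \<Rightarrow> real^'n \<Rightarrow> real^'m^'m" where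
  "lin_pencil A x = (\<Sum>i\<in>UNIV. (x $ i) *\<^sub>R A i)"

definition pencil :: "real^'m^'m \<Rightarrow> ('n::finite \<Rightarrow> real^'m^'m) \<Rightarrow> real^'n \<Rightarrow> real^'m^'m" where
  "pencil A0 A x = lin_pencil A x + A0"

definition spectrahedron :: "real^'m^'m \<Rightarrow> ('n::finite \<Rightarrow> real^'m^'m) \<Rightarrow> (real^'n) set" where
  "spectrahedron A0 A = {x. psd (pencil A0 A x)}"


subsection \<open>The cutting scheme\<close>

text \<open>
  The scheme is applied both in the whole space and with an affine subspace \<open>S\<close> treated as
  the ambient space. A Cartesian coordinate system of \<open>S\<close> is given by an orthonormal basis
  \<open>E\<close> of its direction space. Writing points as \<open>x = a + (\<Sum>b\<in>E. z\<^sub>b *\<^sub>R b)\<close> with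
  \<open>a \<in> S\<close>, the pencil has in the coordinates \<open>z\<close> the constant term \<open>pencil A0 A a\<close> and the
  coefficients \<open>lin_pencil A b\<close>, \<open>b \<in> E\<close>; the unit vectors become the elements of \<open>E\<close>, the
  all-ones vector becomes \<open>\<Sum>E\<close>, and the directions \<open>w\<close> and \<open>d\<close> become elements of
  \<open>span E\<close>. Below everything is expressed in terms of \<open>x\<close> instead of \<open>z\<close>, which makes
  the choice of \<open>a\<close> irrelevant. For \<open>S = UNIV\<close> and \<open>E = Basis\<close> one gets the scheme in
  its usual form, since \<open>lin_pencil A (axis i 1) = A i\<close>.
\<close>

definition ambient_frame :: "'a::euclidean_space set \<Rightarrow> 'a set \<Rightarrow> bool" where
  "ambient_frame S E \<longleftrightarrow>
     affine S \<and> S \<noteq> {} \<and> pairwise orthogonal E \<and> (\<forall>b\<in>E. norm b = 1) \<and>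
     span E = {x - y | x y. x \<in> S \<and> y \<in> S}"

definition init_directions :: "'a::euclidean_space set \<Rightarrow> 'a set" where
  "init_directions E = insert (- (\<Sum>b\<in>E. b)) E"

definition solves_P1 ::
    "(real^'n) set \<Rightarrow> real^'m^'m \<Rightarrow> ('n::finite \<Rightarrow> real^'m^'m) \<Rightarrow> real^'n \<Rightarrow> real^'n \<Rightarrow> bool" where
  "solves_P1 S A0 A w x \<longleftrightarrow>
     is_arg_max (\<lambda>x. w \<bullet> x) (\<lambda>x. x \<in> S \<and> psd (pencil A0 A x)) x"

definition solves_P2 ::
    "real^'m^'m \<Rightarrow> ('n::finite \<Rightarrow> real^'m^'m) \<Rightarrow> real^'n \<Rightarrow> real^'n \<Rightarrow> real^'n \<Rightarrow> real \<Rightarrow> bool" where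
  "solves_P2 A0 A v d x t \<longleftrightarrow>
     is_arg_min (\<lambda>(x, t). t) (\<lambda>(x, t). psd (pencil A0 A x) \<and> x - v - t *\<^sub>R d = 0) (x, t)"

definition solves_D2 ::
    "(real^'n) set \<Rightarrow> real^'m^'m \<Rightarrow> ('n::finite \<Rightarrow> real^'m^'m) \<Rightarrow> real^'n \<Rightarrow> real^'n \<Rightarrow>
     real^'m^'m \<Rightarrow> real^'n \<Rightarrow> bool" where
  "solves_D2 E A0 A v d U w \<longleftrightarrow>
     is_arg_max (\<lambda>(U, w). - mat_inner (pencil A0 A v) U)
       (\<lambda>(U, w). w \<in> span E \<and> (\<forall>b\<in>E. mat_inner (lin_pencil A b) U = w \<bullet> b) \<and>
                 d \<bullet> w = 1 \<and> psd U) (U, w)"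

text \<open>
  \<open>cutting_state \<dots> P c \<kappa>\<close> says that the loop head can be reached with these values of the
  program variables. Solutions of subproblems need not be unique, so a run may use any of them;
  a run in which some required solution does not exist cannot be continued.
\<close>
inductive cutting_state ::
    "(real^'n) set \<Rightarrow> (real^'n) set \<Rightarrow> real^'m^'m \<Rightarrow> ('n::finite \<Rightarrow> real^'m^'m) \<Rightarrow> real \<Rightarrow>
     (real^'n) set \<Rightarrow> real^'n \<Rightarrow> ereal \<Rightarrow> bool"
  for S E A0 A \<epsilon> where
  init:
    "\<lbrakk> \<And>w. w \<in> init_directions E \<Longrightarrow> solves_P1 S A0 A w (xs w);
       P = {x \<in> S. \<forall>w\<in>init_directions E. w \<bullet> x \<le> w \<bullet> xs w};
       c = (1 / real (card E + 1)) *\<^sub>R (\<Sum>w\<in>init_directions E. xs w) \<rbrakk>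
     \<Longrightarrow> cutting_state S E A0 A \<epsilon> P c \<infinity>"
| cut:
    "\<lbrakk> cutting_state S E A0 A \<epsilon> P c \<kappa>; \<kappa> > ereal \<epsilon>;
       \<And>v. v \<in> ext P \<Longrightarrow> solves_P2 A0 A v (c - v) (xs v) (ts v);
       \<And>v. v \<in> ext P \<Longrightarrow> solves_D2 E A0 A v (c - v) (Us v) (ws v);
       is_arg_max (\<lambda>v. ts v * norm (c - v)) (\<lambda>v. v \<in> ext P) vb \<rbrakk>
     \<Longrightarrow> cutting_state S E A0 A \<epsilon>
           (P \<inter> {x. ws vb \<bullet> x \<ge> ws vb \<bullet> vb + ts vb}) c (ereal (ts vb * norm (c - vb)))"

definition cutting_scheme ::
    "(real^'n) set \<Rightarrow> (real^'n) set \<Rightarrow> real^'m^'m \<Rightarrow> ('n::finite \<Rightarrow> real^'m^'m) \<Rightarrow> real \<Rightarrow>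
     (real^'n) set \<Rightarrow> bool" where
  "cutting_scheme S E A0 A \<epsilon> V \<longleftrightarrow>
     (\<exists>P c \<kappa>. cutting_state S E A0 A \<epsilon> P c \<kappa> \<and> \<not> \<kappa> > ereal \<epsilon> \<and> V = ext P)"


subsection \<open>The approximation algorithm for unbounded spectrahedra\<close>

text \<open>The block diagonal matrix with blocks \<open>X\<close> and \<open>r\<close>.\<close>
definition bordered :: "real^'m^'m \<Rightarrow> real \<Rightarrow> real^('m option)^('m option)" where
  "bordered X r = (\<chi> i j. case (i, j) of
       (Some k, Some l) \<Rightarrow> X $ k $ l
     | (None, None) \<Rightarrow> r
     | _ \<Rightarrow> 0)"

definition trace_vec :: "('n::finite \<Rightarrow> real^'m^'m) \<Rightarrow> real^'n" where
  "trace_vec A = (\<chi> i. - mat_inner (A i) (mat 1))"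

definition l1_ball :: "real \<Rightarrow> (real^'n) set" where
  "l1_ball r = {x. (\<Sum>i\<in>UNIV. \<bar>x $ i\<bar>) \<le> r}"

text \<open>
  \<open>algorithm \<dots> P\<close> says that some run of the algorithm arrives at \<open>P\<close>, of which
  it then returns a V-representation.

  \<^item> \<open>M\<close> may be a single point. Its affine hull then is zero-dimensional, where the cutting
    scheme cannot be executed (the only vertex is \<open>v = c\<close>, so \<open>d = 0\<close>); \<open>M\<close> itself is
    used in that case.
  \<^item> On the affine hull of \<open>M\<close> the equation defining \<open>M\<close> holds identically, so \<open>M\<close> is
    represented there by the homogeneous pencil.
  \<^item> \<open>\<mu>\<close> is the minimum of a linear functional, written as an infimum so that no attainment has
    to be presupposed.
  \<^item> The half-space in the definition of \<open>Cb\<close> contributes the additional diagonal entry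
    \<open>w \<bullet> x - (\<mu> - \<epsilon>)\<close> to its pencil.
\<close>
definition algorithm ::
    "real^'m^'m \<Rightarrow> ('n::finite \<Rightarrow> real^'m^'m) \<Rightarrow> real \<Rightarrow> real \<Rightarrow> (real^'n) set \<Rightarrow> bool" where
  "algorithm A0 A \<epsilon> \<delta> P \<longleftrightarrow>
     (\<exists>C w M VM Mb K \<mu> VP.
        C = spectrahedron A0 A \<and>
        w = (1 / norm (trace_vec A)) *\<^sub>R trace_vec A \<and>
        M = recession_cone C \<inter> {x. w \<bullet> x = - (1 + \<delta>)} \<and>
        ((\<exists>p. M = {p}) \<and> VM = M \<or>
         (\<exists>E. ambient_frame (affine hull M) E \<and>
              cutting_scheme (affine hull M) E 0 A (\<delta> / 2) VM)) \<and>
        Mb = convex hull VM + l1_ball (\<delta> / 2) \<and>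
        K = convex_cone hull (ext Mb) \<and>
        \<mu> = (INF y\<in>convex hull (ext (C + K)). w \<bullet> y) \<and>
        cutting_scheme UNIV Basis
          (bordered A0 (- (\<mu> - \<epsilon>))) (\<lambda>i. bordered (A i) (w $ i)) \<epsilon> VP \<and>
        P = convex hull VP + K)"

end

theory Submission
  imports Defs
begin

text \<open>
  Every cut is valid: if a dual optimal solution had a smaller value \<open>s\<close> than the primal
  optimum, the primal problem would also have a feasible point with value \<open>s\<close>. So the cutting
  scheme returns an outer approximation of the required accuracy, whether or not the point \<open>c\<close>
  lies in the interior.

  Write \<open>R\<close> for the recession cone of \<open>C\<close>. The functional \<open>w\<close> is negative on \<open>R - {0}\<close>, and
  adding the \<open>l\<^sub>1\<close>-ball makes \<open>R - {0}\<close> a subset of the interior of \<open>K\<close>. Consequently the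
  points \<open>y\<close> of \<open>C\<close> that are minimal, in the sense that \<open>C \<inter> (y - K) = {y}\<close>, form a bounded
  set. Each point of \<open>C\<close> belongs to \<open>y + K\<close> for some minimal \<open>y\<close>, and applying the Krein-Milman
  theorem to a truncation of \<open>C\<close> shows that \<open>y\<close> is in the convex hull of the extreme points of
  \<open>C + K\<close>. Therefore \<open>y\<close> survives the truncation made by the algorithm, which yields \<open>C \<subseteq> P\<close>.
\<close>

subsection \<open>Positive semidefinite matrices\<close>

lemma psd_sym: "psd X \<Longrightarrow> X $ i $ j = X $ j $ i"
proof -
  assume "psd X"
  then have "transpose X $ j $ i = X $ j $ i" by (simp only: psd_def)
  then show ?thesis by (simp add: transpose_def)
qed

lemma inner_matrix_axis: "axis i 1 \<bullet> ((X :: real^'m^'m) *v axis j 1) = X $ i $ j"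
  by (simp only: matrix_vector_mult_basis inner_axis') (simp add: column_def)

lemma psd_diag_nonneg: "psd X \<Longrightarrow> 0 \<le> X $ i $ i"
  by (metis inner_matrix_axis psd_def)

lemma quadratic_form_add:
  fixes X :: "real^'m^'m"
  assumes "transpose X = X"
  shows "(a + s *\<^sub>R b) \<bullet> (X *v (a + s *\<^sub>R b)) = a \<bullet> (X *v a) + 2 * s * (a \<bullet> (X *v b)) + s\<^sup>2 * (b \<bullet> (X *v b))"
proof -
  have "b \<bullet> (X *v a) = a \<bullet> (X *v b)"
    by (metis assms dot_lmul_matrix inner_commute transpose_matrix_vector)
  then show ?thesis
    by (simp add: matrix_vector_right_distrib inner_add_left inner_add_right
        scaleR_vector_matrix_assoc power2_eq_square algebra_simps flip: scaleR_matrix_vector_assoc)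
qed

text \<open>Along \<open>axis i 1\<close> the quadratic form has no second-order term, so a nonzero
  entry in row \<open>i\<close> would let it become negative.\<close>

lemma psd_row_zero:
  assumes "psd X" "X $ i $ i = 0"
  shows "X $ i = 0"
proof -
  have "X $ i $ j = 0" for j
  proof (rule ccontr)
    assume "X $ i $ j \<noteq> 0"
    \<comment> \<open>Chosen so that the form takes the value \<open>- 1\<close>.\<close>
    define s where "s = - (X $ j $ j + 1) / (2 * X $ i $ j)"
    have "0 \<le> (axis j 1 + s *\<^sub>R axis i 1) \<bullet> (X *v (axis j 1 + s *\<^sub>R axis i 1))"
      using assms(1) psd_def by blast
    also have "\<dots> = X $ j $ j + 2 * s * X $ i $ j"
      using assms psd_sym[OF assms(1), of j i] by (simp add: quadratic_form_add psd_def inner_matrix_axis)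
    also have "\<dots> = - 1"
      using \<open>X $ i $ j \<noteq> 0\<close> by (simp add: s_def field_simps)
    finally show False by simp
  qed
  then show ?thesis by (simp add: vec_eq_iff)
qed

text \<open>The rank-one matrix of \<open>u\<close>. Pairing it with \<open>X\<close> gives the
  quadratic form of \<open>X\<close> at \<open>u\<close>, so test vectors can be turned into dual
  feasible points.\<close>

definition outer :: "real^'m \<Rightarrow> real^'m^'m" where
  "outer u = (\<chi> i j. u $ i * u $ j)"

lemma outer_mult: "outer u *v v = (u \<bullet> v) *\<^sub>R u"
  by (simp add: vec_eq_iff outer_def matrix_vector_mult_def inner_vec_def sum_distrib_left
      sum_distrib_right mult_ac)

lemma psd_outer: "psd (outer u)"
proof -
  have "transpose (outer u) = outer u"
    by (simp add: transpose_def outer_def mult.commute)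
  then show ?thesis
    by (simp add: psd_def outer_mult inner_commute)
qed

lemma mat_inner_sum: "mat_inner X Y = (\<Sum>i\<in>UNIV. \<Sum>k\<in>UNIV. X $ i $ k * Y $ k $ i)"
  by (simp add: mat_inner_def trace_def matrix_matrix_mult_def)

lemma mat_inner_outer: "mat_inner X (outer u) = u \<bullet> (X *v u)"
  by (simp add: mat_inner_sum outer_def inner_vec_def matrix_vector_mult_def sum_distrib_left mult_ac)

lemma mat_inner_add_left: "mat_inner (X + Y) U = mat_inner X U + mat_inner Y U"
  by (simp add: mat_inner_sum sum.distrib algebra_simps)

lemma mat_inner_scaleR_left: "mat_inner (t *\<^sub>R X) U = t * mat_inner X U"
  by (simp add: mat_inner_sum sum_distrib_left mult_ac)

lemma mat_inner_add_right: "mat_inner X (U + V) = mat_inner X U + mat_inner X V"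
  by (simp add: mat_inner_sum sum.distrib algebra_simps)

lemma mat_inner_scaleR_right: "mat_inner X (t *\<^sub>R U) = t * mat_inner X U"
  by (simp add: mat_inner_sum sum_distrib_left mult_ac)

lemma psd_add: "psd X \<Longrightarrow> psd Y \<Longrightarrow> psd (X + Y)"
  by (auto simp: psd_def matrix_vector_mult_add_rdistrib inner_add_right transpose_def vec_eq_iff)

lemma psd_scaleR: "0 \<le> t \<Longrightarrow> psd X \<Longrightarrow> psd (t *\<^sub>R X)"
  by (auto simp: psd_def transpose_scalar simp flip: scaleR_matrix_vector_assoc)

text \<open>Gaussian elimination: subtracting a suitable multiple of the outer square of a nonzero row
  of \<open>U\<close> keeps \<open>U\<close> positive semidefinite and annihilates that row.\<close>

lemma mat_inner_nonneg:
  assumes "psd X" "psd U"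
  shows "0 \<le> mat_inner X U"
  using assms(2)
proof (induction "card {i. U $ i \<noteq> 0}" arbitrary: U rule: less_induct)
  case less
  show ?case
  proof (cases "\<exists>i. U $ i \<noteq> 0")
    case False
    then show ?thesis by (simp add: mat_inner_sum)
  next
    case True
    then obtain i where i: "U $ i \<noteq> 0" by blast
    define r where "r = U $ i $ i"
    define u where "u = U $ i"
    have r: "r > 0"
      using psd_row_zero[OF less.prems, of i] psd_diag_nonneg[OF less.prems, of i] i
      unfolding r_def by (metis order_le_less)
    define U' where "U' = U + (- 1 / r) *\<^sub>R outer u"
    have sym: "transpose U = U" using less.prems psd_def by blast
    have ue: "v \<bullet> (U *v axis i 1) = u \<bullet> v" for v
    proof -
      have "U *v axis i 1 = u"
        using psd_sym[OF less.prems, of i]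
        by (simp add: matrix_vector_mult_basis column_def u_def vec_eq_iff)
      then show ?thesis by (simp add: inner_commute)
    qed
    have "psd U'"
      unfolding psd_def
    proof safe
      show "transpose U' = U'"
        using sym by (simp add: U'_def vec_eq_iff transpose_def outer_def mult.commute)
      fix v
      \<comment> \<open>The minimizer of the form of \<open>U\<close> on the line through
        \<open>v\<close> in direction \<open>axis i 1\<close>; the minimum is the form of
        \<open>U'\<close> at \<open>v\<close>.\<close>
      define s where "s = - (u \<bullet> v) / r"
      have "0 \<le> (v + s *\<^sub>R axis i 1) \<bullet> (U *v (v + s *\<^sub>R axis i 1))"
        using less.prems psd_def by blast
      also have "\<dots> = v \<bullet> (U *v v) + 2 * s * (u \<bullet> v) + s\<^sup>2 * r"
        by (simp add: quadratic_form_add[OF sym] ue inner_matrix_axis r_def)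
          (simp add: u_def cart_eq_inner_axis)
      also have "\<dots> = v \<bullet> (U *v v) - (u \<bullet> v)\<^sup>2 / r"
        using r by (simp add: s_def field_simps power2_eq_square)
      also have "\<dots> = v \<bullet> (U' *v v)"
        by (simp add: U'_def matrix_vector_mult_add_rdistrib outer_mult inner_add_right
            inner_diff_right power2_eq_square inner_commute matrix_vector_mult_diff_rdistrib
            flip: scaleR_matrix_vector_assoc)
      finally show "0 \<le> v \<bullet> (U' *v v)" .
    qed
    have "{j. U' $ j \<noteq> 0} \<subset> {j. U $ j \<noteq> 0}"
    proof
      \<comment> \<open>By symmetry a zero row \<open>j\<close> of \<open>U\<close> gives
        \<open>u $ j = 0\<close>, so no new nonzero row arises and the induction measure
        drops.\<close>
      have "U' $ j = 0" if "U $ j = 0" for j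
        using that psd_sym[OF less.prems, of i j]
        by (simp add: U'_def vec_eq_iff outer_def u_def)
      then show "{j. U' $ j \<noteq> 0} \<subseteq> {j. U $ j \<noteq> 0}" by blast
      have "U' $ i = 0"
        using r by (simp add: U'_def vec_eq_iff outer_def u_def r_def)
      then show "{j. U' $ j \<noteq> 0} \<noteq> {j. U $ j \<noteq> 0}"
        using i by blast
    qed
    then have "0 \<le> mat_inner X U'"
      using less.hyps[OF _ \<open>psd U'\<close>] by (simp add: psubset_card_mono)
    moreover have "mat_inner X U = mat_inner X U' + (1 / r) * mat_inner X (outer u)"
      unfolding U'_def mat_inner_add_right mat_inner_scaleR_right by simp
    moreover have "0 \<le> mat_inner X (outer u)"
      using assms(1) unfolding mat_inner_outer psd_def by blast
    ultimately show ?thesis using r by simp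
  qed
qed

lemma closed_psd: "closed {X :: real^'m^'m. psd X}"
proof -
  have "{X :: real^'m^'m. psd X} = (\<Inter>i. \<Inter>j. {X. X $ j $ i = X $ i $ j}) \<inter> (\<Inter>v. {X. 0 \<le> mat_inner X (outer v)})"
    by (auto simp: psd_def mat_inner_outer transpose_def vec_eq_iff)
  moreover have "closed {X :: real^'m^'m. X $ j $ i = X $ i $ j}" for i j
    by (intro closed_Collect_eq continuous_intros)
  moreover have "closed {X :: real^'m^'m. 0 \<le> mat_inner X (outer v)}" for v
    unfolding mat_inner_sum by (intro closed_Collect_le continuous_intros)
  ultimately show ?thesis by (auto intro!: closed_Int closed_INT)
qed

text \<open>The diagonal entries are nonnegative with sum zero, so each of them vanishes and takes
  its row with it.\<close>

lemma psd_trace_zero: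
  assumes "psd X" "mat_inner X (mat 1) = 0"
  shows "X = 0"
proof -
  have "(\<Sum>i\<in>UNIV. X $ i $ i) = 0"
    using assms(2) by (simp add: mat_inner_def trace_def)
  then have "X $ i $ i = 0" for i
    using psd_diag_nonneg[OF assms(1)] by (simp add: sum_nonneg_eq_0_iff)
  then show ?thesis
    using psd_row_zero[OF assms(1)] by (simp add: vec_eq_iff[of X])
qed

lemma psd_mat_1: "psd (mat 1)"
  by (simp add: psd_def)

text \<open>The quadratic form is the sum of the forms of the two blocks.\<close>

lemma psd_bordered: "psd (bordered X r) \<longleftrightarrow> psd X \<and> 0 \<le> r"
proof -
  have *: "v \<bullet> (bordered X r *v v) = (\<chi> i. v $ Some i) \<bullet> (X *v (\<chi> i. v $ Some i)) + r * (v $ None)\<^sup>2" for v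
    by (simp add: inner_vec_def matrix_vector_mult_def bordered_def UNIV_option_conv
        sum.reindex power2_eq_square)
  have tr: "transpose (bordered X r) = bordered X r \<longleftrightarrow> transpose X = X"
    by (auto simp: vec_eq_iff transpose_def bordered_def split: option.splits)
  have "psd X \<and> 0 \<le> r" if "psd (bordered X r)"
  proof
    show "0 \<le> r"
      using psd_diag_nonneg[OF that, of None] by (simp add: bordered_def)
    have "0 \<le> u \<bullet> (X *v u)" for u
    proof -
      define v :: "real^('a option)" where "v = (\<chi> i. case i of None \<Rightarrow> 0 | Some k \<Rightarrow> u $ k)"
      have "v \<bullet> (bordered X r *v v) = u \<bullet> (X *v u)"
        unfolding * by (simp add: v_def)
      then show ?thesis using that psd_def by metis
    qed
    then show "psd X" using that tr by (simp add: psd_def)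
  qed
  moreover have "psd (bordered X r)" if "psd X" "0 \<le> r"
    using that by (simp add: psd_def tr *)
  ultimately show ?thesis by blast
qed


subsection \<open>Pencils\<close>

lemma linear_lin_pencil: "linear (lin_pencil A)"
  by (auto intro!: linearI
      simp: lin_pencil_def scaleR_add_left sum.distrib scaleR_sum_right)

lemma lin_pencil_sym:
  assumes "\<And>i. transpose (A i) = A i"
  shows "transpose (lin_pencil A x) = lin_pencil A x"
proof -
  have "A i $ k $ j = A i $ j $ k" for i j k
  proof -
    have "transpose (A i) $ j $ k = A i $ j $ k" by (simp only: assms)
    then show ?thesis by (simp add: transpose_def)
  qed
  then show ?thesis
    by (simp add: lin_pencil_def vec_eq_iff transpose_def)
qed

lemma pencil_add: "pencil A0 A (x + d) = pencil A0 A x + lin_pencil A d"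
  by (simp add: pencil_def linear_add[OF linear_lin_pencil])

text \<open>Together with \<open>psd_bordered\<close> this makes the truncation of \<open>C\<close>
  by a half-space a spectrahedron, to which the results on the cutting scheme apply.\<close>

lemma pencil_bordered:
  "pencil (bordered A0 r) (\<lambda>i. bordered (A i) (w $ i)) x = bordered (pencil A0 A x) (w \<bullet> x + r)"
  by (auto simp: vec_eq_iff pencil_def lin_pencil_def bordered_def inner_vec_def mult.commute
      split: option.splits)

lemma pencil_homogeneous: "pencil 0 A x = lin_pencil A x"
  by (simp add: pencil_def)

lemma convex_spectrahedron: "convex (spectrahedron A0 A)"
proof (rule convexI)
  fix x y and a b :: real
  assume xy: "x \<in> spectrahedron A0 A" "y \<in> spectrahedron A0 A" and ab: "0 \<le> a" "0 \<le> b" "a + b = 1"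
  have "pencil A0 A (a *\<^sub>R x + b *\<^sub>R y) = a *\<^sub>R pencil A0 A x + b *\<^sub>R pencil A0 A y"
    using ab(3) scaleR_add_left[of a b A0]
    by (simp add: pencil_def linear_add[OF linear_lin_pencil] linear_cmul[OF linear_lin_pencil]
        scaleR_add_right)
  then show "a *\<^sub>R x + b *\<^sub>R y \<in> spectrahedron A0 A"
    using xy ab by (simp add: spectrahedron_def psd_add psd_scaleR)
qed

section \<open>Limits of psd matrices and recession directions\<close>

lemma tendsto_psd:
  assumes "(f \<longlongrightarrow> X) F" "eventually (\<lambda>n. psd (f n)) F" "F \<noteq> bot"
  shows "psd X"
proof -
  have "X \<in> {X. psd X}"
    by (rule Lim_in_closed_set[OF closed_psd _ assms(3,1)]) (use assms(2) in simp)
  then show ?thesis by simp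
qed

lemma tendsto_inverse_norm:
  assumes "\<And>n. real n \<le> norm (c n)"
  shows "(\<lambda>n. inverse (norm (c n))) \<longlonglongrightarrow> 0"
  by (rule tendsto_inverse_0_at_top, rule filterlim_at_top_mono[OF filterlim_real_sequentially])
    (simp add: assms)

text \<open>Division by \<open>norm (c n)\<close> removes the constant term in the limit, and the
  psd matrices form a closed set.\<close>

lemma psd_limit_direction:
  assumes "\<And>n. psd (pencil A0 A (c n))" "\<And>n. norm (c n) \<ge> real n"
    and "(\<lambda>n. c n /\<^sub>R norm (c n)) \<longlonglongrightarrow> r"
  shows "psd (lin_pencil A r)"
proof (rule tendsto_psd)
  have "(\<lambda>n. lin_pencil A (c n /\<^sub>R norm (c n)) + inverse (norm (c n)) *\<^sub>R A0) \<longlonglongrightarrow> lin_pencil A r + 0 *\<^sub>R A0"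
    by (intro tendsto_intros tendsto_inverse_norm assms
        bounded_linear.tendsto[OF linear_conv_bounded_linear[THEN iffD1, OF linear_lin_pencil]])
  then show "(\<lambda>n. inverse (norm (c n)) *\<^sub>R pencil A0 A (c n)) \<longlonglongrightarrow> lin_pencil A r"
    by (simp add: pencil_def linear_cmul[OF linear_lin_pencil] scaleR_add_right)
qed (simp_all add: assms psd_scaleR)

text \<open>Dividing the pencil at \<open>x + n d\<close> by \<open>n\<close> leaves only
  \<open>lin_pencil A d\<close> in the limit. A base point \<open>x\<close> is essential: over the
  empty set every \<open>d\<close> would be a recession direction.\<close>

lemma recession_cone_spectrahedron:
  fixes A :: "'n::finite \<Rightarrow> real^'m^'m"
  assumes "spectrahedron A0 A \<noteq> {}"
  shows "recession_cone (spectrahedron A0 A) = {x. psd (lin_pencil A x)}"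
proof safe
  fix d assume d: "d \<in> recession_cone (spectrahedron A0 A)"
  obtain x where x: "x \<in> spectrahedron A0 A" using assms by blast
  have p: "psd (pencil A0 A (x + real n *\<^sub>R d))" for n
    using d x by (simp add: recession_cone_def spectrahedron_def)
  show "psd (lin_pencil A d)"
  proof (rule tendsto_psd)
    have "(\<lambda>n. inverse (real (Suc n)) *\<^sub>R pencil A0 A x + lin_pencil A d) \<longlonglongrightarrow> 0 *\<^sub>R pencil A0 A x + lin_pencil A d"
      by (intro tendsto_intros LIMSEQ_inverse_real_of_nat)
    then show "(\<lambda>n. inverse (real (Suc n)) *\<^sub>R pencil A0 A (x + real (Suc n) *\<^sub>R d)) \<longlonglongrightarrow> lin_pencil A d"
      by (simp add: pencil_add linear_cmul[OF linear_lin_pencil] scaleR_add_right del: of_nat_Suc)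
      show "\<forall>\<^sub>F n in sequentially. psd (inverse (real (Suc n)) *\<^sub>R pencil A0 A (x + real (Suc n) *\<^sub>R d))"
      by (intro always_eventually allI psd_scaleR p) simp
  qed simp
next
  fix d assume "psd (lin_pencil A d)"
  then show "d \<in> recession_cone (spectrahedron A0 A)"
    by (auto simp: recession_cone_def spectrahedron_def pencil_add
        linear_cmul[OF linear_lin_pencil] intro: psd_add psd_scaleR)
qed


subsection \<open>The cutting scheme\<close>

lemma orthonormal_sum_inner:
  fixes E :: "'a::euclidean_space set"
  assumes "pairwise orthogonal E" "\<And>b. b \<in> E \<Longrightarrow> norm b = 1" "b \<in> E"
  shows "(\<Sum>c\<in>E. f c *\<^sub>R c) \<bullet> b = f b"
proof -
  have "finite E" using assms(1) by (rule pairwise_orthogonal_imp_finite)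
  moreover have "(\<Sum>c\<in>E. f c *\<^sub>R c) \<bullet> b = (\<Sum>c\<in>E. if c = b then f b else 0)"
    unfolding inner_sum_left
    using assms(1,3) assms(2)[OF assms(3)]
    by (intro sum.cong) (auto simp: pairwise_def orthogonal_def norm_eq_1)
  ultimately show ?thesis using assms(3) by simp
qed

text \<open>Riesz representation with explicit coefficients. It produces the component
  \<open>w\<close> of a dual feasible point from the matrix \<open>U\<close> alone.\<close>

lemma orthonormal_representation:
  fixes f :: "'a::euclidean_space \<Rightarrow> real"
  assumes "pairwise orthogonal E" "\<And>b. b \<in> E \<Longrightarrow> norm b = 1" "linear f"
  obtains w where "w \<in> span E" "\<And>d. d \<in> span E \<Longrightarrow> f d = w \<bullet> d"
proof
  let ?w = "\<Sum>b\<in>E. f b *\<^sub>R b"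
  show "?w \<in> span E"
    by (intro span_sum span_mul span_base)
  show "f d = ?w \<bullet> d" if "d \<in> span E" for d
  proof (rule linear_eq_on_span[OF assms(3) _ _ that])
    show "linear ((\<bullet>) ?w)"
      by (simp add: bounded_linear.linear bounded_linear_inner_right)
    show "f b = ?w \<bullet> b" if "b \<in> E" for b
      using orthonormal_sum_inner[OF assms(1,2) that] by simp
  qed
qed

text \<open>No constraint qualification is needed here because \<open>U\<close> is assumed to be an optimal
  solution of the dual: if its value \<open>s\<close> were smaller than \<open>t\<close>, then the point \<open>v + s d\<close> would
  satisfy all constraints of the primal problem.\<close>

lemma strong_duality:
  fixes A :: "'n::finite \<Rightarrow> real^'m^'m"
  assumes A: "transpose A0 = A0" "\<And>i. transpose (A i) = A i"
    and E: "pairwise orthogonal E" "\<And>b. b \<in> E \<Longrightarrow> norm b = 1" and d: "d \<in> span E"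
    and P2: "solves_P2 A0 A v d x t" and D2: "solves_D2 E A0 A v d U w"
  shows "t \<le> - mat_inner (pencil A0 A v) U"
proof (rule ccontr)
  define s where "s = - mat_inner (pencil A0 A v) U"
  assume "\<not> t \<le> - mat_inner (pencil A0 A v) U"
  then have "s < t" by (simp add: s_def)
  \<comment> \<open>Eliminating \<open>x = v + t d\<close> makes the primal problem
    one-dimensional.\<close>
  have t: "psd (pencil A0 A v + t *\<^sub>R lin_pencil A d)"
    and min: "\<And>t'. psd (pencil A0 A v + t' *\<^sub>R lin_pencil A d) \<Longrightarrow> t \<le> t'"
  proof -
    have x: "x = v + t *\<^sub>R d" "psd (pencil A0 A x)"
      and m: "\<And>x' t'. psd (pencil A0 A x') \<Longrightarrow> x' - v - t' *\<^sub>R d = 0 \<Longrightarrow> \<not> t' < t"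
      using P2 by (auto simp: solves_P2_def is_arg_min_def algebra_simps)
    show "psd (pencil A0 A v + t *\<^sub>R lin_pencil A d)"
      using x by (simp add: pencil_add linear_cmul[OF linear_lin_pencil])
    show "t \<le> t'" if "psd (pencil A0 A v + t' *\<^sub>R lin_pencil A d)" for t'
      using m[of "v + t' *\<^sub>R d" t'] that
      by (simp add: pencil_add linear_cmul[OF linear_lin_pencil])
  qed
  \<comment> \<open>Every psd \<open>U'\<close> with this normalization extends to a dual feasible
    pair: \<open>w'\<close> represents \<open>x \<mapsto> mat_inner (lin_pencil A x) U'\<close> on
    \<open>span E\<close>.\<close>
  have opt: "- mat_inner (pencil A0 A v) U' \<le> s" if U': "psd U'" "mat_inner (lin_pencil A d) U' = 1" for U'
  proof -
    have "linear (\<lambda>x. mat_inner (lin_pencil A x) U')"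
      by (rule linearI) (simp_all add: linear_add[OF linear_lin_pencil] linear_cmul[OF linear_lin_pencil]
          mat_inner_add_left mat_inner_scaleR_left)
    from orthonormal_representation[OF E this] obtain w' where
      "w' \<in> span E" "\<And>d. d \<in> span E \<Longrightarrow> mat_inner (lin_pencil A d) U' = w' \<bullet> d" by blast
    then have "w' \<in> span E \<and> (\<forall>b\<in>E. mat_inner (lin_pencil A b) U' = w' \<bullet> b) \<and> d \<bullet> w' = 1 \<and> psd U'"
      using U' d by (metis inner_commute span_base)
    then show ?thesis
      using D2 unfolding solves_D2_def is_arg_max_def s_def by (force simp: not_less)
  qed
  have "psd (pencil A0 A v + s *\<^sub>R lin_pencil A d)"
    unfolding psd_def
  proof safe
    have "transpose (X + Y) = transpose X + transpose Y" for X Y :: "real^'m^'m"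
      by (simp add: transpose_def vec_eq_iff)
    then show "transpose (pencil A0 A v + s *\<^sub>R lin_pencil A d) = pencil A0 A v + s *\<^sub>R lin_pencil A d"
      by (simp only: pencil_def transpose_scalar lin_pencil_sym[OF A(2)] A(1))
    fix u :: "real^'m"
    define b where "b = mat_inner (pencil A0 A v) (outer u)"
    define q where "q = mat_inner (lin_pencil A d) (outer u)"
    have qf: "u \<bullet> ((pencil A0 A v + r *\<^sub>R lin_pencil A d) *v u) = b + r * q" for r
      by (simp add: b_def q_def flip: mat_inner_outer mat_inner_add_left mat_inner_scaleR_left)
    \<comment> \<open>If \<open>q > 0\<close>, then \<open>outer u\<close> divided by
      \<open>q\<close> is dual feasible, and optimality of \<open>U\<close> gives the bound.
      Otherwise \<open>b + r * q\<close> does not increase with \<open>r\<close> and is nonnegative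
      at \<open>t > s\<close>.\<close>
    have "0 \<le> b + s * q"
    proof (cases "q > 0")
      case True
      have "- mat_inner (pencil A0 A v) ((1 / q) *\<^sub>R outer u) \<le> s"
        using True by (intro opt psd_scaleR psd_outer) (simp_all add: mat_inner_scaleR_right flip: q_def)
      then show ?thesis
        using True by (simp add: mat_inner_scaleR_right field_simps flip: b_def)
    next
      case False
      then have "t * q \<le> s * q"
        using \<open>s < t\<close> by (simp add: mult_right_mono_neg)
      moreover have "0 \<le> b + t * q"
        using t unfolding psd_def by (metis qf)
      ultimately show ?thesis by simp
    qed
    then show "0 \<le> u \<bullet> ((pencil A0 A v + s *\<^sub>R lin_pencil A d) *v u)"
      by (simp add: qf)
  qed
  from min[OF this] \<open>s < t\<close> show False by simp
qed

text \<open>Pairing the pencil at \<open>y\<close> with \<open>U\<close> gives a nonnegative number,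
  which splits into the pairing at \<open>v\<close> and \<open>w \<bullet> (y - v)\<close>. By
  strong duality the pairing at \<open>v\<close> is at most \<open>- t\<close>.\<close>

lemma valid_cut:
  fixes A :: "'n::finite \<Rightarrow> real^'m^'m"
  assumes A: "transpose A0 = A0" "\<And>i. transpose (A i) = A i"
    and E: "pairwise orthogonal E" "\<And>b. b \<in> E \<Longrightarrow> norm b = 1" and d: "d \<in> span E"
    and P2: "solves_P2 A0 A v d x t" and D2: "solves_D2 E A0 A v d U w"
    and y: "y - v \<in> span E" "psd (pencil A0 A y)"
  shows "w \<bullet> v + t \<le> w \<bullet> y"
proof -
  have U: "psd U" and w: "w \<in> span E" "\<And>b. b \<in> E \<Longrightarrow> mat_inner (lin_pencil A b) U = w \<bullet> b"
    using D2 by (auto simp: solves_D2_def is_arg_max_def)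
  have "mat_inner (lin_pencil A (y - v)) U = w \<bullet> (y - v)"
  proof (rule linear_eq_on_span[OF _ _ w(2) y(1)])
    show "linear (\<lambda>x. mat_inner (lin_pencil A x) U)"
      by (rule linearI) (simp_all add: linear_add[OF linear_lin_pencil] linear_cmul[OF linear_lin_pencil]
          mat_inner_add_left mat_inner_scaleR_left)
    show "linear ((\<bullet>) w)"
      by (simp add: bounded_linear.linear bounded_linear_inner_right)
  qed
  moreover have "mat_inner (pencil A0 A y) U = mat_inner (pencil A0 A v) U + mat_inner (lin_pencil A (y - v)) U"
    using pencil_add[of A0 A v "y - v"] by (simp add: mat_inner_add_left)
  moreover have "0 \<le> mat_inner (pencil A0 A y) U"
    using y(2) U by (rule mat_inner_nonneg)
  ultimately show ?thesis
    using strong_duality[OF A E d P2 D2] by (simp add: inner_diff_right)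
qed

text \<open>Each coordinate with respect to \<open>E\<close> is bounded above by its own constraint,
  and below by the constraint for the negative sum together with the upper bounds on the other
  coordinates.\<close>

lemma polytope_initial:
  fixes E :: "'a::euclidean_space set"
  assumes F: "ambient_frame S E"
  shows "polytope {x \<in> S. \<forall>w\<in>init_directions E. w \<bullet> x \<le> \<beta> w}" (is "polytope ?P")
proof -
  have E: "pairwise orthogonal E" "\<And>b. b \<in> E \<Longrightarrow> norm b = 1"
    and S: "affine S" "S \<noteq> {}" "\<And>x y. x \<in> S \<Longrightarrow> y \<in> S \<Longrightarrow> x - y \<in> span E"
    using F unfolding ambient_frame_def by blast+
  have fin: "finite E" using E(1) by (rule pairwise_orthogonal_imp_finite)
  obtain a where a: "a \<in> S" using S(2) by blast
  have "?P = S \<inter> (\<Inter>w\<in>init_directions E. {x. w \<bullet> x \<le> \<beta> w})" by blast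
  moreover have "polyhedron (S \<inter> (\<Inter>w\<in>init_directions E. {x. w \<bullet> x \<le> \<beta> w}))"
  proof (intro polyhedron_Int polyhedron_Inter affine_imp_polyhedron[OF S(1)])
    show "finite ((\<lambda>w. {x. w \<bullet> x \<le> \<beta> w}) ` init_directions E)"
      using fin by (simp add: init_directions_def)
  qed (use polyhedron_halfspace_le in blast)
  moreover have "bounded ?P"
  proof -
    \<comment> \<open>The bounds after moving the origin to \<open>a\<close>, enlarged to be
      nonnegative.\<close>
    define \<gamma> where "\<gamma> b = \<bar>\<beta> b\<bar> + \<bar>b \<bullet> a\<bar>" for b
    define \<sigma> where "\<sigma> = - (\<Sum>b\<in>E. b)"
    have "norm (x - a) \<le> (\<Sum>b\<in>E. (\<Sum>b\<in>E. \<gamma> b) + \<gamma> \<sigma>)" if x: "x \<in> ?P" for x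
    proof -
      have g: "w \<bullet> (x - a) \<le> \<gamma> w" if "w \<in> init_directions E" for w
      proof -
        have "w \<bullet> x \<le> \<beta> w" using x that by blast
        then show ?thesis
          unfolding \<gamma>_def by (simp add: inner_diff_right)
      qed
      have \<gamma>: "0 \<le> \<gamma> b" for b by (simp add: \<gamma>_def)
      have nrm: "norm (x - a) \<le> (\<Sum>b\<in>E. \<bar>b \<bullet> (x - a)\<bar>)"
      proof -
        let ?y = "\<Sum>b\<in>E. (b \<bullet> (x - a)) *\<^sub>R b"
        have b: "(x - a) \<bullet> b = ?y \<bullet> b" if "b \<in> E" for b
          using orthonormal_sum_inner[OF E that] by (simp add: inner_commute)
        have xa: "x - a \<in> span E" using x a S(3) by blast
        have "(x - a) \<bullet> (x - a) = ?y \<bullet> (x - a)"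
          by (rule linear_eq_on_span[OF _ _ b xa])
            (simp_all add: bounded_linear.linear bounded_linear_inner_right)
        also have "\<dots> \<le> norm ?y * norm (x - a)"
          by (rule norm_cauchy_schwarz)
        finally have "norm (x - a) \<le> norm ?y"
          by (cases "x = a") (simp_all add: dot_square_norm power2_eq_square)
        also have "\<dots> \<le> (\<Sum>b\<in>E. \<bar>b \<bullet> (x - a)\<bar>)"
          using E(2) by (intro sum_norm_le) simp
        finally show ?thesis .
      qed
      also have "\<dots> \<le> (\<Sum>b\<in>E. (\<Sum>b\<in>E. \<gamma> b) + \<gamma> \<sigma>)"
      proof (rule sum_mono)
        fix b assume b: "b \<in> E"
        have up: "c \<bullet> (x - a) \<le> \<gamma> c" if "c \<in> E" for c
          using g that by (simp add: init_directions_def)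
        have "- (\<Sum>b\<in>E. b \<bullet> (x - a)) \<le> \<gamma> \<sigma>"
          using g[of \<sigma>] by (simp add: init_directions_def \<sigma>_def inner_sum_left)
        moreover have "(\<Sum>c\<in>E. c \<bullet> (x - a)) = b \<bullet> (x - a) + (\<Sum>c\<in>E-{b}. c \<bullet> (x - a))"
          using fin b by (rule sum.remove)
        moreover have "(\<Sum>c\<in>E-{b}. c \<bullet> (x - a)) \<le> (\<Sum>c\<in>E-{b}. \<gamma> c)"
          by (rule sum_mono) (use up in blast)
        moreover have "(\<Sum>c\<in>E. \<gamma> c) = \<gamma> b + (\<Sum>c\<in>E-{b}. \<gamma> c)"
          using fin b by (rule sum.remove)
        moreover have "0 \<le> (\<Sum>c\<in>E-{b}. \<gamma> c)"
          by (simp add: sum_nonneg \<gamma>)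
        ultimately show "\<bar>b \<bullet> (x - a)\<bar> \<le> (\<Sum>b\<in>E. \<gamma> b) + \<gamma> \<sigma>"
          using up[OF b] \<gamma>[of b] \<gamma>[of \<sigma>] by linarith
      qed
      finally show ?thesis .
    qed
    then have "?P \<subseteq> cball a (\<Sum>b\<in>E. (\<Sum>b\<in>E. \<gamma> b) + \<gamma> \<sigma>)"
      by (auto simp: dist_norm norm_minus_commute)
    then show ?thesis using bounded_cball bounded_subset by blast
  qed
  ultimately show ?thesis
    by (simp add: polytope_eq_bounded_polyhedron)
qed

text \<open>The weights sum to \<open>1\<close> only if there are exactly \<open>card E + 1\<close>
  directions.\<close>

lemma init_directions_mean:
  fixes E :: "'a::euclidean_space set"
  assumes E: "pairwise orthogonal E" "\<And>b. b \<in> E \<Longrightarrow> norm b = 1"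
    and "convex T" "\<And>w. w \<in> init_directions E \<Longrightarrow> xs w \<in> T"
  shows "(1 / real (card E + 1)) *\<^sub>R (\<Sum>w\<in>init_directions E. xs w) \<in> T"
proof -
  have fin: "finite E" using E(1) by (rule pairwise_orthogonal_imp_finite)
  \<comment> \<open>The inner product of the sum with an element of \<open>E\<close> is
    \<open>1\<close>, but with its own negative it is at most \<open>0\<close>.\<close>
  have "- (\<Sum>b\<in>E. b) \<notin> E"
  proof
    assume b: "- (\<Sum>b\<in>E. b) \<in> E"
    have "(\<Sum>b\<in>E. 1 *\<^sub>R b) \<bullet> - (\<Sum>b\<in>E. b) = 1"
      using orthonormal_sum_inner[OF E b] .
    then have "(\<Sum>b\<in>E. b) \<bullet> (\<Sum>b\<in>E. b) = - 1" by simp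
    then show False by (metis inner_ge_zero neg_0_le_iff_le not_one_le_zero)
  qed
  then have card: "card (init_directions E) = card E + 1" "finite (init_directions E)"
    using fin by (simp_all add: init_directions_def)
  have "(\<Sum>w\<in>init_directions E. (1 / real (card E + 1)) *\<^sub>R xs w) \<in> T"
    using assms(3,4) card by (intro convex_sum) auto
  then show ?thesis by (simp add: scaleR_sum_right)
qed

text \<open>This carries a distance estimate from the vertices of a polytope to the whole
  polytope.\<close>

lemma convex_near:
  fixes T :: "'a::real_normed_vector set"
  assumes "convex T"
  shows "convex {x. \<exists>y\<in>T. norm (x - y) \<le> r}"
proof (rule convexI)
  fix x x' and a b :: real
  assume "x \<in> {x. \<exists>y\<in>T. norm (x - y) \<le> r}" "x' \<in> {x. \<exists>y\<in>T. norm (x - y) \<le> r}"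
    and ab: "0 \<le> a" "0 \<le> b" "a + b = 1"
  then obtain y y' where y: "y \<in> T" "norm (x - y) \<le> r" "y' \<in> T" "norm (x' - y') \<le> r" by blast
  have "norm (a *\<^sub>R x + b *\<^sub>R x' - (a *\<^sub>R y + b *\<^sub>R y')) = norm (a *\<^sub>R (x - y) + b *\<^sub>R (x' - y'))"
    by (simp add: algebra_simps)
  also have "\<dots> \<le> a * norm (x - y) + b * norm (x' - y')"
    using norm_triangle_ineq[of "a *\<^sub>R (x - y)" "b *\<^sub>R (x' - y')"] ab by simp
  also have "\<dots> \<le> a * r + b * r"
    using y ab by (intro add_mono mult_left_mono) auto
  also have "\<dots> = r"
    using ab(3) by (metis distrib_right mult_1)
  finally have "norm (a *\<^sub>R x + b *\<^sub>R x' - (a *\<^sub>R y + b *\<^sub>R y')) \<le> r" .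
  moreover have "a *\<^sub>R y + b *\<^sub>R y' \<in> T"
    using assms y ab by (simp add: convexD)
  ultimately show "a *\<^sub>R x + b *\<^sub>R x' \<in> {x. \<exists>y\<in>T. norm (x - y) \<le> r}" by blast
qed

text \<open>The maximum with \<open>0\<close> is needed because \<open>\<kappa>\<close> is negative when all vertices lie in the
  spectrahedron.\<close>

lemma cutting_state_invariant:
  fixes A :: "'n::finite \<Rightarrow> real^'m^'m"
  assumes A: "transpose A0 = A0" "\<And>i. transpose (A i) = A i"
    and F: "ambient_frame S E"
    and "cutting_state S E A0 A \<epsilon> P c \<kappa>"
  shows "polytope P \<and> S \<inter> spectrahedron A0 A \<subseteq> P \<and> P \<subseteq> S \<and> c \<in> S \<inter> spectrahedron A0 A \<and>
    (\<forall>x\<in>P. \<exists>y\<in>S \<inter> spectrahedron A0 A. ereal (norm (x - y)) \<le> max 0 \<kappa>)"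
  using assms(4)
proof induction
  have E: "pairwise orthogonal E" "\<And>b. b \<in> E \<Longrightarrow> norm b = 1"
    and S: "affine S" "\<And>x y. x \<in> S \<Longrightarrow> y \<in> S \<Longrightarrow> x - y \<in> span E"
    using F unfolding ambient_frame_def by blast+
  let ?T = "S \<inter> spectrahedron A0 A"
  have T: "convex ?T"
    using S(1) by (simp add: convex_Int affine_imp_convex convex_spectrahedron)
  {
    case (init xs P c)
    have xs: "xs w \<in> ?T" "\<And>x. x \<in> ?T \<Longrightarrow> w \<bullet> x \<le> w \<bullet> xs w" if "w \<in> init_directions E" for w
      using init(1)[OF that] by (auto simp: solves_P1_def is_arg_max_def spectrahedron_def not_less)
    have "polytope P"
      unfolding init(2) by (rule polytope_initial[OF F])
    moreover have "c \<in> ?T"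
      unfolding init(3) by (rule init_directions_mean[OF E T]) (use xs in auto)
    moreover have "?T \<subseteq> P" "P \<subseteq> S"
      using xs unfolding init(2) by auto
    ultimately show ?case by (auto simp: max_def)
  next
    case (cut P c \<kappa> xs ts Us ws vb)
    let ?P' = "P \<inter> {x. ws vb \<bullet> vb + ts vb \<le> ws vb \<bullet> x}"
    let ?r = "max 0 (ts vb * norm (c - vb))"
    have vb: "vb \<in> ext P" and max: "\<And>v. v \<in> ext P \<Longrightarrow> ts v * norm (c - v) \<le> ts vb * norm (c - vb)"
      using cut(5) by (auto simp: is_arg_max_def not_less)
    have ext: "v \<in> S" if "v \<in> ext P" for v
      using that cut.IH by (auto simp: ext_def extreme_point_of_def)
    have T': "?T \<subseteq> ?P'"
    proof
      fix y assume y: "y \<in> ?T"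
      have "ws vb \<bullet> vb + ts vb \<le> ws vb \<bullet> y"
        using y ext[OF vb] cut.IH S(2)
        by (intro valid_cut[OF A E _ cut(3)[OF vb] cut(4)[OF vb]]) (auto simp: spectrahedron_def)
      then show "y \<in> ?P'" using y cut.IH by blast
    qed
    have x: "xs v = v + ts v *\<^sub>R (c - v)" "psd (pencil A0 A (xs v))" if "v \<in> ext P" for v
      using cut(3)[OF that] by (auto simp: solves_P2_def is_arg_min_def algebra_simps)
    have near: "\<exists>y\<in>?T. norm (v - y) \<le> ?r" if v: "v \<in> ext P" for v
    proof (cases "ts v \<ge> 0")
      case True
      have "xs v = (1 - ts v) *\<^sub>R v + ts v *\<^sub>R c" by (simp add: x(1)[OF v] algebra_simps)
      then have "xs v \<in> S"
        using mem_affine[OF S(1) ext[OF v], of c "1 - ts v" "ts v"] cut.IH by auto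
      moreover have "norm (v - xs v) = ts v * norm (c - v)"
        using True by (simp add: x(1)[OF v])
      ultimately show ?thesis
        using x(2)[OF v] max[OF v] by (intro bexI[of _ "xs v"]) (auto simp: spectrahedron_def)
    next
      case False
      then have t: "ts v < 0" by simp
      \<comment> \<open>For negative \<open>ts v\<close> the ray from \<open>c\<close> through
        \<open>v\<close> reaches \<open>xs v\<close> only beyond \<open>v\<close>. This
        \<open>s\<close> is the weight that exhibits \<open>v\<close> as a convex combination of the
        feasible points \<open>c\<close> and \<open>xs v\<close>.\<close>
      define s where "s = 1 / (1 - ts v)"
      have s: "0 \<le> s" "s \<le> 1" "s * (1 - ts v) = 1" using t by (auto simp: s_def)
      have "(1 - s) *\<^sub>R c + s *\<^sub>R xs v = c + (s * (1 - ts v)) *\<^sub>R (v - c)"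
        by (simp add: x(1)[OF v] algebra_simps)
      then have "v = (1 - s) *\<^sub>R c + s *\<^sub>R xs v" using s(3) by simp
      moreover have "(1 - s) *\<^sub>R c + s *\<^sub>R xs v \<in> spectrahedron A0 A"
        using s(1,2) x(2)[OF v] cut.IH
        by (intro convexD[OF convex_spectrahedron]) (auto simp: spectrahedron_def)
      ultimately have "v \<in> ?T" using ext[OF v] by simp
      then show ?thesis by (intro bexI[of _ v]) auto
    qed
    \<comment> \<open>The new \<kappa> is computed from the vertices of the uncut \<open>P\<close>,
      so the estimate is shown for \<open>P\<close> and then inherited by its subset
      \<open>?P'\<close>.\<close>
    have "P = convex hull ext P"
      unfolding ext_def using cut.IH
      by (intro Krein_Milman_Minkowski) (auto simp: polytope_imp_compact polytope_imp_convex)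
    then have "P \<subseteq> {x. \<exists>y\<in>?T. norm (x - y) \<le> ?r}"
      using hull_minimal[of "ext P" "{x. \<exists>y\<in>?T. norm (x - y) \<le> ?r}" convex] convex_near[OF T] near
      by blast
    then have "\<forall>x\<in>?P'. \<exists>y\<in>?T. ereal (norm (x - y)) \<le> max 0 (ereal (ts vb * norm (c - vb)))"
      unfolding zero_ereal_def max_def ereal_less_eq by (auto split: if_splits)
    moreover have "polytope ?P'"
      using cut.IH polyhedron_halfspace_ge by (intro polytope_Int_polyhedron) auto
    ultimately show ?case using T' cut.IH by blast
  }
qed

lemma cutting_scheme_approximation:
  fixes A :: "'n::finite \<Rightarrow> real^'m^'m"
  assumes A: "transpose A0 = A0" "\<And>i. transpose (A i) = A i"
    and F: "ambient_frame S E" and "cutting_scheme S E A0 A \<epsilon> V" "0 \<le> \<epsilon>"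
  shows "finite V" "S \<inter> spectrahedron A0 A \<noteq> {}"
    "S \<inter> spectrahedron A0 A \<subseteq> convex hull V" "convex hull V \<subseteq> S"
    "\<And>x. x \<in> convex hull V \<Longrightarrow> \<exists>y\<in>S \<inter> spectrahedron A0 A. norm (x - y) \<le> \<epsilon>"
proof -
  obtain P c \<kappa> where st: "cutting_state S E A0 A \<epsilon> P c \<kappa>" and \<kappa>: "\<kappa> \<le> ereal \<epsilon>" and V: "V = ext P"
    using assms(4) by (auto simp: cutting_scheme_def not_less)
  note inv = cutting_state_invariant[OF A F st]
  have P: "P = convex hull V"
    unfolding V ext_def using inv
    by (intro Krein_Milman_Minkowski) (auto simp: polytope_imp_compact polytope_imp_convex)
  show "finite V"
    unfolding V ext_def using inv by (simp add: finite_polyhedron_extreme_points polytope_imp_polyhedron)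
  show "S \<inter> spectrahedron A0 A \<noteq> {}" using inv by blast
  show "S \<inter> spectrahedron A0 A \<subseteq> convex hull V" "convex hull V \<subseteq> S"
    using inv P by auto
  fix x assume "x \<in> convex hull V"
  then obtain y where "y \<in> S \<inter> spectrahedron A0 A" "ereal (norm (x - y)) \<le> max 0 \<kappa>"
    using inv P by blast
  moreover have "max 0 \<kappa> \<le> ereal \<epsilon>" using \<kappa> assms(5) by simp
  ultimately show "\<exists>y\<in>S \<inter> spectrahedron A0 A. norm (x - y) \<le> \<epsilon>"
    by (metis ereal_less_eq(3) order_trans)
qed


subsection \<open>Sums of convex sets and cones\<close>

text \<open>The \<open>l1\<close> norm is the maximum of \<open>s \<bullet> x\<close> over the
  finitely many sign vectors \<open>s\<close>.\<close>

lemma polytope_l1_ball: "polytope (l1_ball r :: (real^'n) set)"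
proof -
  define B where "B = {s :: real^'n. \<forall>i. s $ i \<in> {-1, 1}}"
  have "finite B"
  proof (rule finite_subset)
    show "B \<subseteq> (\<lambda>f. \<chi> i. f i) ` (UNIV \<rightarrow>\<^sub>E {-1, 1})"
    proof
      fix s assume "s \<in> B"
      then have "($) s \<in> UNIV \<rightarrow>\<^sub>E {-1, 1}" by (auto simp: B_def)
      moreover have "s = (\<chi> i. s $ i)" by (simp add: vec_eq_iff)
      ultimately show "s \<in> (\<lambda>f. \<chi> i. f i) ` (UNIV \<rightarrow>\<^sub>E {-1, 1})" by blast
    qed
  qed (intro finite_imageI finite_PiE, auto)
  have "l1_ball r = (\<Inter>s\<in>B. {x. s \<bullet> x \<le> r})"
  proof safe
    fix x s :: "real^'n" assume x: "x \<in> l1_ball r" and s: "s \<in> B"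
    have "s \<bullet> x \<le> (\<Sum>i\<in>UNIV. \<bar>x $ i\<bar>)"
      unfolding inner_vec_def
    proof (rule sum_mono)
      fix i
      have "s $ i = - 1 \<or> s $ i = 1" using s by (auto simp: B_def)
      then show "s $ i \<bullet> x $ i \<le> \<bar>x $ i\<bar>" by auto
    qed
    then show "s \<bullet> x \<le> r" using x by (simp add: l1_ball_def)
  next
    fix x :: "real^'n" assume x: "x \<in> (\<Inter>s\<in>B. {x. s \<bullet> x \<le> r})"
    define s :: "real^'n" where "s = (\<chi> i. if 0 \<le> x $ i then 1 else - 1)"
    have "s \<in> B" by (simp add: B_def s_def)
    then have "s \<bullet> x \<le> r" using x by blast
    moreover have "s \<bullet> x = (\<Sum>i\<in>UNIV. \<bar>x $ i\<bar>)"
      unfolding inner_vec_def by (intro sum.cong) (auto simp: s_def)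
    ultimately show "x \<in> l1_ball r" by (simp add: l1_ball_def)
  qed
  moreover have "polyhedron (\<Inter>s\<in>B. {x. s \<bullet> x \<le> r})"
    using \<open>finite B\<close> by (intro polyhedron_Inter) (auto intro: polyhedron_halfspace_le)
  moreover have "bounded (l1_ball r :: (real^'n) set)"
    unfolding bounded_iff l1_ball_def using norm_le_l1_cart order_trans by blast
  ultimately show ?thesis by (simp add: polytope_eq_bounded_polyhedron)
qed

lemma ball_subset_l1_ball:
  assumes "r > 0"
  obtains e where "e > 0" "ball 0 e \<subseteq> (l1_ball r :: (real^'n) set)"
proof
  show "r / real CARD('n) > 0" using assms by simp
  show "ball 0 (r / real CARD('n)) \<subseteq> (l1_ball r :: (real^'n) set)"
  proof
    fix x :: "real^'n" assume "x \<in> ball 0 (r / real CARD('n))"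
    then have "real CARD('n) * norm x < r" by (simp add: field_simps)
    moreover have "(\<Sum>i\<in>UNIV. \<bar>x $ i\<bar>) \<le> (\<Sum>i\<in>(UNIV :: 'n set). norm x)"
      by (intro sum_mono component_le_norm_cart)
    ultimately show "x \<in> l1_ball r" by (simp add: l1_ball_def)
  qed
qed

lemma polytope_set_plus:
  fixes S T :: "'a::euclidean_space set"
  assumes "polytope S" "polytope T"
  shows "polytope (S + T)"
proof -
  obtain U V where "finite U" "S = convex hull U" "finite V" "T = convex hull V"
    using assms by (auto simp: polytope_def)
  then show ?thesis
    unfolding polytope_def by (metis convex_hull_set_plus finite_set_plus)
qed

text \<open>For \<open>k \<noteq> 0\<close> the point \<open>b + k\<close> is the midpoint of
  \<open>b\<close> and \<open>b + 2 k\<close>.\<close>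

lemma ext_set_plus_cone:
  assumes "b + k \<in> ext (B + K)" "b \<in> B" "k \<in> K" "convex_cone K"
  shows "k = 0"
proof (rule ccontr)
  assume "k \<noteq> 0"
  have "b + 0 \<in> B + K" "b + 2 *\<^sub>R k \<in> B + K"
    using assms convex_cone_contains_0[OF assms(4)] convex_cone_scaleR[OF assms(4), of 2 k]
    by (blast intro: set_plus_intro, intro set_plus_intro) auto
  moreover have "b + k \<in> open_segment (b + 0) (b + 2 *\<^sub>R k)"
    unfolding in_segment using \<open>k \<noteq> 0\<close> by (auto intro!: exI[of _ "1/2"] simp: algebra_simps)
  ultimately show False
    using assms(1) by (auto simp: ext_def extreme_point_of_def)
qed

lemma ext_set_plus_cone_subset:
  assumes "convex_cone K"
  shows "ext (B + K) \<subseteq> B"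
proof
  fix x assume x: "x \<in> ext (B + K)"
  then have "x \<in> B + K" by (simp add: ext_def extreme_point_of_def)
  then obtain b k where "x = b + k" "b \<in> B" "k \<in> K" by (rule set_plus_elim)
  then show "x \<in> B" using ext_set_plus_cone[of b k B K] assms x by auto
qed

text \<open>For the harder inclusion, dividing \<open>b + n d = b' + k\<close> by \<open>n\<close>
  makes the bounded part disappear, so \<open>d\<close> is a limit of points of the closed cone
  \<open>K\<close>.\<close>

lemma recession_cone_set_plus:
  fixes B :: "'a::euclidean_space set"
  assumes "bounded B" "B \<noteq> {}" and K: "convex_cone K" "closed K"
  shows "recession_cone (B + K) = K"
proof
  show "K \<subseteq> recession_cone (B + K)"
  proof
    fix d assume d: "d \<in> K"
    show "d \<in> recession_cone (B + K)"
      unfolding recession_cone_def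
    proof clarify
      fix x t assume "x \<in> B + K" "(0::real) \<le> t"
      then obtain b k where "x = b + k" "b \<in> B" "k \<in> K" by (auto elim: set_plus_elim)
      then have "b + (k + t *\<^sub>R d) \<in> B + K"
        using K(1) d \<open>0 \<le> t\<close> by (intro set_plus_intro convex_cone_add convex_cone_scaleR)
      then show "x + t *\<^sub>R d \<in> B + K" by (simp add: \<open>x = b + k\<close> add.assoc)
    qed
  qed
  show "recession_cone (B + K) \<subseteq> K"
  proof
    fix d assume d: "d \<in> recession_cone (B + K)"
    obtain b where b: "b \<in> B" using assms(2) by blast
    then have "b \<in> B + K"
      using set_plus_intro[OF b convex_cone_contains_0[OF K(1)]] by simp
    then have "\<exists>b'\<in>B. \<exists>k\<in>K. b + real (Suc n) *\<^sub>R d = b' + k" for n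
    proof -
      have "b + real (Suc n) *\<^sub>R d \<in> B + K"
        using d \<open>b \<in> B + K\<close> by (simp add: recession_cone_def del: of_nat_Suc)
      then show ?thesis by (blast elim: set_plus_elim)
    qed
    then obtain b' k where bk: "\<And>n. b' n \<in> B" "\<And>n. k n \<in> K" "\<And>n. b + real (Suc n) *\<^sub>R d = b' n + k n"
      by metis
    have k: "inverse (real (Suc n)) *\<^sub>R k n = d - inverse (real (Suc n)) *\<^sub>R (b' n - b)" for n
    proof -
      have "k n = real (Suc n) *\<^sub>R d - (b' n - b)" using bk(3)[of n] by (simp add: algebra_simps)
      then show ?thesis by (simp only: scaleR_diff_right scaleR_scaleR) (simp del: of_nat_Suc)
    qed
    obtain \<rho> where \<rho>: "\<And>x. x \<in> B \<Longrightarrow> norm x \<le> \<rho>"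
      using assms(1) unfolding bounded_iff by blast
    have "(\<lambda>n. inverse (real (Suc n)) *\<^sub>R (b' n - b)) \<longlonglongrightarrow> 0"
    proof (rule Lim_null_comparison)
      have "norm (b' n - b) \<le> 2 * \<rho>" for n
        using norm_triangle_ineq4[of "b' n" b] \<rho>[OF b] \<rho>[OF bk(1)[of n]] by linarith
      then show "\<forall>\<^sub>F n in sequentially. norm (inverse (real (Suc n)) *\<^sub>R (b' n - b)) \<le> inverse (real (Suc n)) * (2 * \<rho>)"
        by (intro always_eventually allI) (simp add: mult_left_mono del: of_nat_Suc)
      show "(\<lambda>n. inverse (real (Suc n)) * (2 * \<rho>)) \<longlonglongrightarrow> 0"
        using tendsto_mult_left_zero[OF LIMSEQ_inverse_real_of_nat] .
    qed
    then have "(\<lambda>n. inverse (real (Suc n)) *\<^sub>R k n) \<longlonglongrightarrow> d - 0"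
      unfolding k by (intro tendsto_intros)
    then have "(\<lambda>n. inverse (real (Suc n)) *\<^sub>R k n) \<longlonglongrightarrow> d" by (simp only: diff_zero)
    moreover have "inverse (real (Suc n)) *\<^sub>R k n \<in> K" for n
      using K(1) bk(2) by (intro convex_cone_scaleR) auto
    ultimately show "d \<in> K"
      using closed_sequentially[OF K(2), of "\<lambda>n. inverse (real (Suc n)) *\<^sub>R k n"] by blast
  qed
qed

text \<open>The witness is the point closest to \<open>k\<close> on the ray through
  \<open>m\<close>: the origin if \<open>k \<bullet> m \<le> 0\<close>, otherwise the orthogonal
  projection of \<open>k\<close>.\<close>

lemma ray_projection:
  fixes k m :: "'a::real_inner"
  assumes "0 \<le> \<alpha>"
  obtains s where "0 \<le> s" "norm (s *\<^sub>R m) \<le> norm k" "norm (k - s *\<^sub>R m) \<le> norm (k - \<alpha> *\<^sub>R m)"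
proof (cases "k \<bullet> m \<le> 0")
  case True
  have "norm k \<le> norm (k - \<alpha> *\<^sub>R m)"
  proof -
    have "(k - \<alpha> *\<^sub>R m) \<bullet> (k - \<alpha> *\<^sub>R m) = k \<bullet> k - 2 * (\<alpha> * (k \<bullet> m)) + \<alpha>\<^sup>2 * (m \<bullet> m)"
      by (simp add: inner_diff_left inner_diff_right inner_commute[of m k] power2_eq_square
          algebra_simps)
    moreover have "\<alpha> * (k \<bullet> m) \<le> 0" using True assms by (simp add: mult_nonneg_nonpos)
    moreover have "0 \<le> \<alpha>\<^sup>2 * (m \<bullet> m)" by simp
    ultimately show ?thesis unfolding norm_le by linarith
  qed
  then show ?thesis using that[of 0] by simp
next
  case False
  define s where "s = k \<bullet> m / (m \<bullet> m)"
  have m: "m \<bullet> m > 0" using False by auto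
  have s: "s * (m \<bullet> m) = k \<bullet> m" using m by (simp add: s_def)
  have "0 \<le> s" using False m by (simp add: s_def)
  \<comment> \<open>Completing the square around the minimizer \<open>s\<close>.\<close>
  have e: "(k - r *\<^sub>R m) \<bullet> (k - r *\<^sub>R m) = k \<bullet> k - s\<^sup>2 * (m \<bullet> m) + (r - s)\<^sup>2 * (m \<bullet> m)" for r
    by (simp add: inner_diff_left inner_diff_right inner_commute[of m k] power2_eq_square
        flip: s) (simp add: algebra_simps)
  have "norm (s *\<^sub>R m) \<le> norm k"
    using e[of s] inner_ge_zero[of "k - s *\<^sub>R m"] unfolding norm_le by (simp add: power2_eq_square)
  moreover have "norm (k - s *\<^sub>R m) \<le> norm (k - \<alpha> *\<^sub>R m)"
    unfolding norm_le e using m by simp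
  ultimately show ?thesis using that \<open>0 \<le> s\<close> by blast
qed

text \<open>The approximating point also has to lie in the unit ball; projecting onto the ray through
  \<open>m\<close> ensures this.\<close>

lemma cone_dist_le:
  fixes K R :: "'a::real_inner set"
  assumes "0 \<le> \<delta>" and R: "R \<subseteq> K" "\<And>r s. r \<in> R \<Longrightarrow> 0 \<le> s \<Longrightarrow> s *\<^sub>R r \<in> R"
    and K: "\<And>k. k \<in> K \<Longrightarrow> \<exists>\<alpha>\<ge>0. \<exists>m' m. k = \<alpha> *\<^sub>R m' \<and> m \<in> R \<and> norm (m' - m) \<le> \<delta> \<and> 1 + \<delta> \<le> norm m"
  shows "cone_dist K R \<le> ereal \<delta>"
proof -
  have "excess (K \<inter> cball 0 1) (R \<inter> cball 0 1) \<le> ereal \<delta>"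
    unfolding excess_def
  proof (rule SUP_least)
    fix k assume k: "k \<in> K \<inter> cball 0 1"
    then obtain \<alpha> m' m where h: "0 \<le> \<alpha>" "k = \<alpha> *\<^sub>R m'" "m \<in> R" "norm (m' - m) \<le> \<delta>" "1 + \<delta> \<le> norm m"
      using K by blast
    \<comment> \<open>Here the distance \<open>1 + \<delta>\<close> matters: it keeps
      \<open>m'\<close> out of the open unit ball, so \<open>\<alpha> \<le> 1\<close> and scaling by
      \<alpha> does not enlarge the error.\<close>
    have "1 \<le> norm m'"
      using h(4,5) norm_triangle_ineq2[of m m'] by (simp add: norm_minus_commute)
    then have "\<alpha> \<le> 1"
      using k h(1,2) mult_left_mono[of 1 "norm m'" \<alpha>] by simp
    have "norm (k - \<alpha> *\<^sub>R m) = \<alpha> * norm (m' - m)"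
      using h(1,2) by (simp flip: scaleR_diff_right)
    also have "\<dots> \<le> 1 * \<delta>"
      using h(1,4) \<open>\<alpha> \<le> 1\<close> by (intro mult_mono) auto
    finally have d: "norm (k - \<alpha> *\<^sub>R m) \<le> \<delta>" by simp
    obtain s where s: "0 \<le> s" "norm (s *\<^sub>R m) \<le> norm k" "norm (k - s *\<^sub>R m) \<le> norm (k - \<alpha> *\<^sub>R m)"
      using ray_projection[OF h(1)] by blast
    have "s *\<^sub>R m \<in> R \<inter> cball 0 1"
      using s(1,2) k R(2)[OF h(3)] by simp
    moreover have "ereal (norm (k - s *\<^sub>R m)) \<le> ereal \<delta>" using s(3) d by simp
    ultimately show "(INF y\<in>R \<inter> cball 0 1. ereal (norm (k - y))) \<le> ereal \<delta>"
      by (rule INF_lower2)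
  qed
  moreover have "excess (R \<inter> cball 0 1) (K \<inter> cball 0 1) \<le> ereal \<delta>"
    unfolding excess_def
  proof (rule SUP_least)
    fix r assume "r \<in> R \<inter> cball 0 1"
    then show "(INF y\<in>K \<inter> cball 0 1. ereal (norm (r - y))) \<le> ereal \<delta>"
      using R(1) assms(1) by (intro INF_lower2[of r]) auto
  qed
  ultimately show ?thesis
    by (simp add: cone_dist_def hausdorff_dist_def)
qed


subsection \<open>Minimal points with respect to a cone\<close>

text \<open>Suppose \<open>e\<close> lies inside a segment of \<open>C + K\<close>. Minimality kills
  the cone parts of both endpoints, so the segment lies in \<open>C\<close>. Shrunk towards
  \<open>e\<close> it also stays above level \<open>L\<close>, against extremality in the
  truncation.\<close>

lemma minimal_extreme:
  fixes C K :: "'a::euclidean_space set"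
  assumes C: "convex C" and K: "convex_cone K" and neg: "\<And>k. k \<in> K \<Longrightarrow> k \<noteq> 0 \<Longrightarrow> w \<bullet> k < 0"
    and e: "e \<in> C" "\<And>z. z \<in> C \<Longrightarrow> e - z \<in> K \<Longrightarrow> z = e"
    and L: "L < w \<bullet> e" "e extreme_point_of (C \<inter> {x. L \<le> w \<bullet> x})"
  shows "e \<in> ext (C + K)"
proof -
  have "e \<in> C + K"
    using set_plus_intro[OF e(1) convex_cone_contains_0[OF K]] by simp
  moreover have False if ab: "a \<in> C + K" "b \<in> C + K" "e \<in> open_segment a b" for a b
  proof -
    obtain c1 k1 where 1: "a = c1 + k1" "c1 \<in> C" "k1 \<in> K" using ab(1) by (rule set_plus_elim)
    obtain c2 k2 where 2: "b = c2 + k2" "c2 \<in> C" "k2 \<in> K" using ab(2) by (rule set_plus_elim)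
    obtain u where u: "0 < u" "u < 1" "e = (1 - u) *\<^sub>R a + u *\<^sub>R b" and "a \<noteq> b"
      using ab(3) unfolding in_segment by blast
    define z where "z = (1 - u) *\<^sub>R c1 + u *\<^sub>R c2"
    have ez: "e - z = (1 - u) *\<^sub>R k1 + u *\<^sub>R k2"
      by (simp add: u(3) 1(1) 2(1) z_def algebra_simps)
    have "z \<in> C" unfolding z_def using C 1(2) 2(2) u by (intro convexD) auto
    moreover have "e - z \<in> K"
      unfolding ez using K 1(3) 2(3) u by (intro convex_cone_add convex_cone_scaleR) auto
    ultimately have "(1 - u) *\<^sub>R k1 + u *\<^sub>R k2 = 0" using e(2) ez by fastforce
    then have sum: "(1 - u) * (w \<bullet> k1) + u * (w \<bullet> k2) = 0"
      by (metis inner_add_right inner_scaleR_right inner_zero_right)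
    have np: "w \<bullet> k \<le> 0" if "k \<in> K" for k
      using neg[OF that] by (cases "k = 0") auto
    have "(1 - u) * (w \<bullet> k1) \<le> 0" "u * (w \<bullet> k2) \<le> 0"
      using np 1(3) 2(3) u by (simp_all add: mult_nonneg_nonpos)
    then have "(1 - u) * (w \<bullet> k1) = 0" "u * (w \<bullet> k2) = 0" using sum by linarith+
    then have "w \<bullet> k1 = 0" "w \<bullet> k2 = 0" using u by auto
    then have "k1 = 0" "k2 = 0"
      using neg 1(3) 2(3) by force+
    then have abC: "a \<in> C" "b \<in> C" using 1 2 by auto
    \<comment> \<open>\<open>q\<close> bounds the change of \<open>w\<close> from \<open>e\<close>
      to either endpoint; \<open>s\<close> shrinks the segment until this change fits into the slack
      \<open>w \<bullet> e - L\<close>.\<close>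
    define q where "q = 1 + \<bar>w \<bullet> (a - e)\<bar> + \<bar>w \<bullet> (b - e)\<bar>"
    define s where "s = min 1 ((w \<bullet> e - L) / q)"
    have q: "q > 0" by (simp add: q_def add_pos_nonneg)
    have s: "0 < s" "s \<le> 1" using q L(1) by (auto simp: s_def)
    have sq: "s * q \<le> w \<bullet> e - L"
      using q by (simp add: s_def min_def field_simps)
    have in_L: "e + s *\<^sub>R (x - e) \<in> C \<inter> {x. L \<le> w \<bullet> x}" if "x \<in> C" "\<bar>w \<bullet> (x - e)\<bar> \<le> q" for x
    proof -
      have "e + s *\<^sub>R (x - e) = (1 - s) *\<^sub>R e + s *\<^sub>R x" by (simp add: algebra_simps)
      also have "\<dots> \<in> C" using C e(1) that s by (intro convexD) auto
      finally have "e + s *\<^sub>R (x - e) \<in> C" .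
      moreover have "- (s * (w \<bullet> (x - e))) \<le> s * q"
        using s that(2) mult_left_mono[of "- (w \<bullet> (x - e))" q s] by auto
      ultimately show ?thesis using sq by (simp add: inner_add_right)
    qed
    have "e + s *\<^sub>R (a - e) \<in> C \<inter> {x. L \<le> w \<bullet> x}" "e + s *\<^sub>R (b - e) \<in> C \<inter> {x. L \<le> w \<bullet> x}"
      using abC by (intro in_L; simp add: q_def)+
    moreover have "e \<in> open_segment (e + s *\<^sub>R (a - e)) (e + s *\<^sub>R (b - e))"
      unfolding in_segment
    proof (intro conjI exI[of _ u])
      show "e + s *\<^sub>R (a - e) \<noteq> e + s *\<^sub>R (b - e)" using s \<open>a \<noteq> b\<close> by simp
      have "(1 - u) *\<^sub>R (e + s *\<^sub>R (a - e)) + u *\<^sub>R (e + s *\<^sub>R (b - e)) =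
        e + s *\<^sub>R (((1 - u) *\<^sub>R a + u *\<^sub>R b) - e)"
        by (simp add: algebra_simps)
      then show "e = (1 - u) *\<^sub>R (e + s *\<^sub>R (a - e)) + u *\<^sub>R (e + s *\<^sub>R (b - e))"
        by (simp flip: u(3))
    qed (use u in auto)
    ultimately show False using L(2) unfolding extreme_point_of_def by blast
  qed
  ultimately show ?thesis by (auto simp: ext_def extreme_point_of_def)
qed

text \<open>A point maximizing \<open>w\<close> over \<open>C \<inter> (x - K)\<close> is minimal. If a minimal point is a convex
  combination of extreme points of a truncation of \<open>C\<close>, then these are minimal as well, and hence
  bounded away from the truncating hyperplane.\<close>

lemma minimal_point_in_hull:
  fixes C K :: "'a::euclidean_space set"
  assumes C: "convex C" "closed C" and K: "convex_cone K" "closed K"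
    and neg: "\<And>k. k \<in> K \<Longrightarrow> k \<noteq> 0 \<Longrightarrow> w \<bullet> k < 0"
    and bdd: "\<And>L. bounded (C \<inter> {x. L \<le> w \<bullet> x})"
    and c: "c \<in> C" "bounded {y \<in> C. y - c \<notin> K}" and x: "x \<in> C"
  obtains y where "y \<in> C" "x - y \<in> K" "y \<in> convex hull (ext (C + K))"
proof -
  have np: "w \<bullet> k \<le> 0" if "k \<in> K" for k
    using neg[OF that] by (cases "k = 0") auto
  let ?T = "C \<inter> (\<lambda>y. x - y) -` K"
  have "closed ?T"
    using C(2) K(2) by (intro closed_Int continuous_closed_vimage continuous_intros)
  moreover have "?T \<subseteq> C \<inter> {y. w \<bullet> x \<le> w \<bullet> y}"
    using np by (fastforce simp: inner_diff_right)
  then have "bounded ?T" using bdd bounded_subset by blast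
  ultimately have "compact ?T" by (simp add: compact_eq_bounded_closed)
  moreover have "x \<in> ?T" using x convex_cone_contains_0[OF K(1)] by simp
  ultimately obtain y where y: "y \<in> ?T" and max: "\<And>z. z \<in> ?T \<Longrightarrow> w \<bullet> z \<le> w \<bullet> y"
    using continuous_attains_sup[of ?T "\<lambda>z. w \<bullet> z"] continuous_on_inner[OF continuous_on_const continuous_on_id]
    by blast
  have minimal: "z = y" if z: "z \<in> C" "y - z \<in> K" for z
  proof (rule ccontr)
    assume "z \<noteq> y"
    then have "w \<bullet> (y - z) < 0" using neg z(2) by simp
    moreover have "(x - y) + (y - z) \<in> K" using y z(2) K(1) by (intro convex_cone_add) auto
    then have "w \<bullet> z \<le> w \<bullet> y" using z(1) by (intro max) simp
    ultimately show False by (simp add: inner_diff_right)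
  qed
  have "bounded (insert c {y \<in> C. y - c \<notin> K})" using c(2) by simp
  then obtain \<rho> where \<rho>: "\<And>z. z \<in> insert c {y \<in> C. y - c \<notin> K} \<Longrightarrow> norm z \<le> \<rho>"
    unfolding bounded_iff by blast
  \<comment> \<open>A minimal point \<open>z\<close> other than \<open>c\<close> has
    \<open>z - c \<notin> K\<close>, hence norm at most \<rho>. Cauchy-Schwarz bounds
    \<open>w\<close> below on minimal points, and the extra \<open>1\<close> makes the inequality
    strict.\<close>
  define L where "L = - (norm w * \<rho>) - 1"
  have L: "L < w \<bullet> z" if "z \<in> C" "\<And>z'. z' \<in> C \<Longrightarrow> z - z' \<in> K \<Longrightarrow> z' = z" for z
  proof -
    have "z \<in> insert c {y \<in> C. y - c \<notin> K}" using that c(1) by blast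
    then have "norm w * norm z \<le> norm w * \<rho>" using \<rho> by (intro mult_left_mono) auto
    then show ?thesis
      using Cauchy_Schwarz_ineq2[of w z] by (simp add: L_def)
  qed
  let ?CL = "C \<inter> {x. L \<le> w \<bullet> x}"
  have CL: "convex ?CL" "compact ?CL"
    using C bdd by (auto simp: convex_Int convex_halfspace_ge compact_eq_bounded_closed closed_Int closed_halfspace_ge)
  have "y \<in> ?CL" using y L minimal by fastforce
  then have "y \<in> convex hull {e. e extreme_point_of ?CL}"
    using Krein_Milman_Minkowski[OF CL(2,1)] by simp
  then obtain S u where S: "finite S" "S \<subseteq> {e. e extreme_point_of ?CL}"
    and u: "\<And>v. v \<in> S \<Longrightarrow> 0 \<le> u v" "sum u S = 1" "(\<Sum>v\<in>S. u v *\<^sub>R v) = y"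
    unfolding convex_hull_explicit by auto
  \<comment> \<open>Minimality passes from \<open>y\<close> only to the points of positive
    weight.\<close>
  define S' where "S' = {v \<in> S. u v \<noteq> 0}"
  have SC: "v \<in> C" if "v \<in> S" for v
    using S(2) that by (auto simp: extreme_point_of_def)
  have "e \<in> ext (C + K)" if "e \<in> S'" for e
  proof -
    have e: "e \<in> S" "u e > 0" using that u(1)[of e] by (auto simp: S'_def)
    have emin: "z = e" if z: "z \<in> C" "e - z \<in> K" for z
    proof -
      \<comment> \<open>Exchanging \<open>e\<close> for \<open>z\<close> in the combination moves
        \<open>y\<close> to a point of \<open>C\<close> that differs from it by \<open>u e\<close>
        times \<open>e - z\<close>, an element of \<open>K\<close>. Minimality of \<open>y\<close>
        makes the difference zero.\<close>
      define f where "f v = (if v = e then z else v)" for v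
      have "(\<Sum>v\<in>S. u v *\<^sub>R f v) \<in> C"
        using S(1) C(1) u SC z(1) by (intro convex_sum) (auto simp: f_def)
      moreover have "y - (\<Sum>v\<in>S. u v *\<^sub>R f v) = (\<Sum>v\<in>S. if v = e then u e *\<^sub>R (e - z) else 0)"
        unfolding u(3)[symmetric] sum_subtractf[symmetric]
        by (intro sum.cong) (auto simp: f_def scaleR_diff_right)
      then have d: "y - (\<Sum>v\<in>S. u v *\<^sub>R f v) = u e *\<^sub>R (e - z)"
        using S(1) e(1) by simp
      moreover have "u e *\<^sub>R (e - z) \<in> K"
        using K(1) e(2) z(2) by (intro convex_cone_scaleR) auto
      ultimately have "(\<Sum>v\<in>S. u v *\<^sub>R f v) = y" by (intro minimal) auto
      then show ?thesis using d e(2) by simp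
    qed
    show ?thesis
      using S(2) e(1) SC L emin by (intro minimal_extreme[OF C(1) K(1) neg, of e L]) auto
  qed
  moreover have "y \<in> convex hull S'"
  proof -
    have "(\<Sum>v\<in>S'. u v *\<^sub>R v) = y" "sum u S' = 1"
      unfolding u(3)[symmetric] u(2)[symmetric] S'_def using S(1)
      by (auto intro!: sum.mono_neutral_left)
    then show ?thesis
      unfolding convex_hull_explicit using S(1) u(1) by (auto simp: S'_def intro!: exI[of _ S'] exI[of _ u])
  qed
  ultimately have "y \<in> convex hull (ext (C + K))"
    by (meson hull_mono subsetD subsetI)
  then show ?thesis using that y by blast
qed

text \<open>Compactness of the unit sphere yields a convergent subsequence of normalized points, and
  its limit is a recession direction.\<close>

lemma unbounded_direction:
  fixes A :: "'n::finite \<Rightarrow> real^'m^'m"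
  assumes "T \<subseteq> spectrahedron A0 A" "\<not> bounded T"
  obtains c r where "\<And>n. c n \<in> T" "\<And>n. norm (c n) > real n"
    "(\<lambda>n. c n /\<^sub>R norm (c n)) \<longlonglongrightarrow> r" "norm r = 1" "psd (lin_pencil A r)"
proof -
  have "\<exists>x\<in>T. norm x > real n" for n
    using assms(2) unfolding bounded_iff by (meson not_le)
  then obtain c where c: "\<And>n. c n \<in> T" "\<And>n. norm (c n) > real n" by metis
  have "c n /\<^sub>R norm (c n) \<in> sphere 0 1" for n
    using c(2)[of n] by (cases "c n = 0") auto
  then obtain r \<phi> where r: "r \<in> sphere 0 1" "strict_mono \<phi>"
    "((\<lambda>n. c n /\<^sub>R norm (c n)) \<circ> \<phi>) \<longlonglongrightarrow> r"
    using seq_compactE[of "sphere 0 1" "\<lambda>n. c n /\<^sub>R norm (c n)"] compact_imp_seq_compact[OF compact_sphere]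
    by metis
  have n: "norm (c (\<phi> n)) > real n" for n
    using c(2)[of "\<phi> n"] seq_suble[OF r(2), of n] by linarith
  have lim: "(\<lambda>n. c (\<phi> n) /\<^sub>R norm (c (\<phi> n))) \<longlonglongrightarrow> r" using r(3) by (simp add: o_def)
  show ?thesis
  proof
    show "psd (lin_pencil A r)"
      using c(1) assms(1) n
      by (intro psd_limit_direction[OF _ _ lim, of A0]) (auto simp: spectrahedron_def less_imp_le)
  qed (use c n lim r in auto)
qed


subsection \<open>Correctness of the algorithm\<close>

lemma ambient_frame_UNIV: "ambient_frame UNIV (Basis :: 'a::euclidean_space set)"
proof -
  have "x \<in> {x - y |x y. x \<in> UNIV \<and> y \<in> UNIV}" for x :: 'a
    by (auto intro: exI[of _ x] exI[of _ 0])
  then show ?thesis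
    unfolding ambient_frame_def
    by (auto simp: pairwise_def orthogonal_def inner_Basis)
qed

lemma transpose_bordered:
  assumes "transpose X = X"
  shows "transpose (bordered X r) = bordered X r"
proof -
  have "transpose X $ i $ j = X $ i $ j" for i j by (simp only: assms)
  then show ?thesis
    by (auto simp: vec_eq_iff transpose_def bordered_def split: option.splits)
qed

text \<open>The inner product is minus the trace of the psd matrix \<open>lin_pencil A x\<close>.
  Trace zero would make this matrix vanish, so \<open>x\<close> and \<open>- x\<close> would both be
  recession directions.\<close>

lemma recession_direction_neg:
  fixes A :: "'n::finite \<Rightarrow> real^'m^'m"
  assumes "line_free (spectrahedron A0 A)" "spectrahedron A0 A \<noteq> {}"
    and x: "psd (lin_pencil A x)" "x \<noteq> 0"
  shows "trace_vec A \<bullet> x < 0"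
proof -
  have tr: "trace_vec A \<bullet> x = - mat_inner (lin_pencil A x) (mat 1)"
  proof -
    have "mat_inner (lin_pencil A x) (mat 1) = (\<Sum>i\<in>UNIV. x $ i * mat_inner (A i) (mat 1))"
    proof -
      have "mat_inner (\<Sum>i\<in>I. B i) (mat 1) = (\<Sum>i\<in>I. mat_inner (B i) (mat 1))"
        for I and B :: "'n \<Rightarrow> real^'m^'m"
      proof (induction I rule: infinite_finite_induct)
        case (insert x F)
        then show ?case by (simp add: mat_inner_add_left)
      qed (simp_all add: mat_inner_sum)
      then show ?thesis by (simp add: lin_pencil_def mat_inner_scaleR_left)
    qed
    then show ?thesis
      by (simp add: trace_vec_def inner_vec_def sum_negf mult.commute)
  qed
  have "0 \<le> mat_inner (lin_pencil A x) (mat 1)"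
    using x(1) psd_mat_1 by (rule mat_inner_nonneg)
  moreover have "mat_inner (lin_pencil A x) (mat 1) \<noteq> 0"
  proof
    assume "mat_inner (lin_pencil A x) (mat 1) = 0"
    then have 0: "lin_pencil A x = 0" using x(1) by (intro psd_trace_zero)
    then have "lin_pencil A (- x) = 0" by (simp add: linear_neg[OF linear_lin_pencil])
    then have "psd (lin_pencil A (- x))" using x(1) 0 by simp
    then have "x \<in> recession_cone (spectrahedron A0 A) \<inter> uminus ` recession_cone (spectrahedron A0 A)"
      using x(1) unfolding recession_cone_spectrahedron[OF assms(2)] by (auto intro: image_eqI[of _ _ "- x"])
    then show False using assms(1) x(2) unfolding line_free_def by blast
  qed
  ultimately show ?thesis using tr by linarith
qed

text \<open>\<open>M\<close> is a base of the recession cone of \<open>C\<close> at distance at least \<open>1 + \<delta>\<close> from the origin,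
  and \<open>B\<close> approximates it in the hyperplane containing it. Adding the \<open>l\<^sub>1\<close>-ball puts \<open>M\<close> into the
  interior of the cone generated by \<open>B + l1_ball (\<delta>/2)\<close>.\<close>

lemma outer_cone:
  fixes w :: "real^'n"
  assumes "0 < \<delta>" and w: "norm w = 1"
    and R: "\<And>r s. r \<in> R \<Longrightarrow> 0 \<le> s \<Longrightarrow> s *\<^sub>R r \<in> R" "\<And>r. r \<in> R \<Longrightarrow> r \<noteq> 0 \<Longrightarrow> w \<bullet> r < 0"
    and M: "M = R \<inter> {x. w \<bullet> x = - (1 + \<delta>)}" "M \<noteq> {}"
    and B: "polytope B" "M \<subseteq> B" "B \<subseteq> {x. w \<bullet> x = - (1 + \<delta>)}"
      "\<And>x. x \<in> B \<Longrightarrow> \<exists>y\<in>M. norm (x - y) \<le> \<delta> / 2"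
    and K: "K = convex_cone hull (ext (B + l1_ball (\<delta> / 2)))"
  shows "finite (ext (B + l1_ball (\<delta> / 2)))" "convex_cone K" "closed K"
    "\<And>k. k \<in> K \<Longrightarrow> k \<noteq> 0 \<Longrightarrow> w \<bullet> k < 0"
    "\<And>r. r \<in> R \<Longrightarrow> r \<noteq> 0 \<Longrightarrow> r \<in> interior K"
    "R \<subseteq> K" "cone_dist K R \<le> ereal \<delta>"
proof -
  let ?Q = "B + l1_ball (\<delta> / 2)"
  have Q: "polytope ?Q" using B(1) polytope_l1_ball by (rule polytope_set_plus)
  have hull: "?Q = convex hull ext ?Q"
    unfolding ext_def using Q
    by (intro Krein_Milman_Minkowski) (auto simp: polytope_imp_compact polytope_imp_convex)
  show fin: "finite (ext ?Q)"
    unfolding ext_def using Q by (simp add: finite_polyhedron_extreme_points polytope_imp_polyhedron)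
  show K1: "convex_cone K" unfolding K by (rule convex_cone_convex_cone_hull)
  show "closed K" unfolding K using fin by (simp add: polyhedron_convex_cone_hull polyhedron_imp_closed)
  obtain e where e: "e > 0" "ball 0 e \<subseteq> (l1_ball (\<delta> / 2) :: (real^'n) set)"
    using ball_subset_l1_ball[of "\<delta> / 2"] assms(1) by auto
  have QK: "?Q \<subseteq> K"
    unfolding K using hull convex_hull_subset_convex_cone_hull by metis
  have "?Q \<noteq> {}"
  proof -
    have "(0 :: real^'n) \<in> l1_ball (\<delta> / 2)" using e by auto
    then show ?thesis using M(2) B(2) by (auto intro: set_plus_intro)
  qed
  then have "ext ?Q \<noteq> {}" using hull by auto
  then have Kq: "\<exists>s\<ge>0. \<exists>q\<in>?Q. k = s *\<^sub>R q" if "k \<in> K" for k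
    using that hull unfolding K by (auto simp: convex_cone_hull_convex_hull_nonempty)
  have Qnear: "\<exists>m\<in>M. norm (q - m) \<le> \<delta>" and Qneg: "w \<bullet> q < 0" if "q \<in> ?Q" for q
  proof -
    obtain b l where bl: "q = b + l" "b \<in> B" "l \<in> l1_ball (\<delta> / 2)"
      using \<open>q \<in> ?Q\<close> by (rule set_plus_elim)
    have l: "norm l \<le> \<delta> / 2"
      using bl(3) norm_le_l1_cart[of l] by (simp add: l1_ball_def)
    obtain m where m: "m \<in> M" "norm (b - m) \<le> \<delta> / 2" using B(4) bl(2) by blast
    have "q - m = (b - m) + l" by (simp add: bl(1))
    then have "norm (q - m) \<le> norm (b - m) + norm l" by (simp only: norm_triangle_ineq)
    then have "norm (q - m) \<le> \<delta>" using l m(2) by linarith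
    then show "\<exists>m\<in>M. norm (q - m) \<le> \<delta>" using m(1) by blast
    \<comment> \<open>The ball moves the level \<open>- (1 + \<delta>)\<close> by at most
      \<open>\<delta> / 2\<close>, so \<open>w\<close> stays negative on \<open>?Q\<close>.\<close>
    have "w \<bullet> l \<le> \<delta> / 2" using norm_cauchy_schwarz[of w l] w l by simp
    moreover have "w \<bullet> b = - (1 + \<delta>)" using B(3) bl(2) by blast
    ultimately show "w \<bullet> q < 0" using assms(1) by (simp add: bl(1) inner_add_right)
  qed
  show "w \<bullet> k < 0" if "k \<in> K" "k \<noteq> 0" for k
  proof -
    obtain s q where sq: "0 \<le> s" "q \<in> ?Q" "k = s *\<^sub>R q" using Kq[OF \<open>k \<in> K\<close>] by blast
    then have "s > 0" using that(2) by (cases "s = 0") auto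
    then show ?thesis using Qneg[OF sq(2)] by (simp add: sq(3) mult_pos_neg)
  qed
  show int: "r \<in> interior K" if r: "r \<in> R" "r \<noteq> 0" for r
  proof -
    \<comment> \<open>Scales \<open>r\<close> into \<open>M\<close>. The ball of radius
      \<open>e\<close> around \<open>s r\<close> lies in \<open>?Q\<close>, and scaling back gives
      radius \<open>e / s\<close> around \<open>r\<close>.\<close>
    define s where "s = (1 + \<delta>) / - (w \<bullet> r)"
    have "s > 0" using R(2)[OF r] assms(1) by (simp add: s_def divide_pos_neg)
    have "w \<bullet> (s *\<^sub>R r) = - (1 + \<delta>)"
      using R(2)[OF r] by (simp add: s_def)
    then have M': "s *\<^sub>R r \<in> M" using R(1)[OF r(1)] \<open>s > 0\<close> M by simp
    have "ball r (e / s) \<subseteq> K"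
    proof
      fix z assume "z \<in> ball r (e / s)"
      then have "norm (s *\<^sub>R (z - r)) < e"
        using \<open>s > 0\<close> by (simp add: dist_norm norm_minus_commute pos_less_divide_eq mult.commute
            del: scaleR_right_diff_distrib)
      then have "s *\<^sub>R (z - r) \<in> l1_ball (\<delta> / 2)"
        using e(2) by (auto simp: subset_iff)
      then have "s *\<^sub>R r + s *\<^sub>R (z - r) \<in> ?Q"
        using M' B(2) by (intro set_plus_intro) auto
      then have "s *\<^sub>R z \<in> K" using QK by (auto simp: scaleR_diff_right)
      then show "z \<in> K"
        using convex_cone_scaleR[OF K1, of "1 / s" "s *\<^sub>R z"] \<open>s > 0\<close> by simp
    qed
    then show ?thesis
      using \<open>s > 0\<close> e(1) by (auto simp: mem_interior intro!: exI[of _ "e / s"])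
  qed
  show RK: "R \<subseteq> K"
    using int interior_subset convex_cone_contains_0[OF K1] by fastforce
  show "cone_dist K R \<le> ereal \<delta>"
  proof (rule cone_dist_le)
    fix k assume "k \<in> K"
    then obtain s q where sq: "0 \<le> s" "q \<in> ?Q" "k = s *\<^sub>R q" using Kq[OF \<open>k \<in> K\<close>] by blast
    obtain m where m: "m \<in> M" "norm (q - m) \<le> \<delta>" using Qnear[OF sq(2)] by blast
    have "w \<bullet> m = - (1 + \<delta>)" using m(1) M(1) by simp
    then have "1 + \<delta> \<le> norm m"
      using norm_cauchy_schwarz[of "- w" m] w by simp
    then show "\<exists>\<alpha>\<ge>0. \<exists>m' m. k = \<alpha> *\<^sub>R m' \<and> m \<in> R \<and> norm (m' - m) \<le> \<delta> \<and> 1 + \<delta> \<le> norm m"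
      using sq m M(1) by blast
  qed (use assms(1) RK R(1) in auto)
qed

text \<open>An unbounded truncation would have a limit direction \<open>r\<close> with
  \<open>w \<bullet> r \<ge> 0\<close>.\<close>

lemma spectrahedron_truncations_bounded:
  fixes A :: "'n::finite \<Rightarrow> real^'m^'m"
  assumes neg: "\<And>r. psd (lin_pencil A r) \<Longrightarrow> r \<noteq> 0 \<Longrightarrow> w \<bullet> r < 0"
  shows "bounded (spectrahedron A0 A \<inter> {x. L \<le> w \<bullet> x})"
proof (rule ccontr)
  assume unb: "\<not> bounded (spectrahedron A0 A \<inter> {x. L \<le> w \<bullet> x})"
  obtain c r where c: "\<And>n. c n \<in> spectrahedron A0 A \<inter> {x. L \<le> w \<bullet> x}" "\<And>n. norm (c n) > real n"
    and lim: "(\<lambda>n. c n /\<^sub>R norm (c n)) \<longlonglongrightarrow> r" and r: "norm r = 1" "psd (lin_pencil A r)"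
    using unbounded_direction[OF _ unb] by blast
  have inv: "(\<lambda>n. inverse (norm (c n))) \<longlonglongrightarrow> 0"
    by (rule tendsto_inverse_norm) (simp add: c(2) less_imp_le)
  have "0 * L \<le> w \<bullet> r"
  proof (rule LIMSEQ_le)
    show "(\<lambda>n. inverse (norm (c n)) * L) \<longlonglongrightarrow> 0 * L"
      by (intro tendsto_intros inv)
    show "(\<lambda>n. w \<bullet> (c n /\<^sub>R norm (c n))) \<longlonglongrightarrow> w \<bullet> r"
      by (intro tendsto_intros lim)
    show "\<exists>N. \<forall>n\<ge>N. inverse (norm (c n)) * L \<le> w \<bullet> (c n /\<^sub>R norm (c n))"
      using c(1) by (auto intro!: mult_left_mono)
  qed
  moreover have "w \<bullet> r < 0" using neg r by fastforce
  ultimately show False by simp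
qed

text \<open>Along an unbounded sequence the shift by \<open>p\<close> becomes negligible after
  normalization, so the scaled points eventually enter the open set
  \<open>interior K\<close>.\<close>

lemma spectrahedron_outside_cone_bounded:
  fixes A :: "'n::finite \<Rightarrow> real^'m^'m"
  assumes K: "convex_cone K" and int: "\<And>r. psd (lin_pencil A r) \<Longrightarrow> r \<noteq> 0 \<Longrightarrow> r \<in> interior K"
  shows "bounded {y \<in> spectrahedron A0 A. y - p \<notin> K}"
proof (rule ccontr)
  assume unb: "\<not> bounded {y \<in> spectrahedron A0 A. y - p \<notin> K}"
  obtain c r where c: "\<And>n. c n \<in> {y \<in> spectrahedron A0 A. y - p \<notin> K}" "\<And>n. norm (c n) > real n"
    and lim: "(\<lambda>n. c n /\<^sub>R norm (c n)) \<longlonglongrightarrow> r" and r: "norm r = 1" "psd (lin_pencil A r)"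
    using unbounded_direction[OF _ unb] by blast
  have inv: "(\<lambda>n. inverse (norm (c n))) \<longlonglongrightarrow> 0"
    by (rule tendsto_inverse_norm) (simp add: c(2) less_imp_le)
  have "(\<lambda>n. c n /\<^sub>R norm (c n) - inverse (norm (c n)) *\<^sub>R p) \<longlonglongrightarrow> r - 0 *\<^sub>R p"
    by (intro tendsto_intros lim inv)
  then have "(\<lambda>n. inverse (norm (c n)) *\<^sub>R (c n - p)) \<longlonglongrightarrow> r"
    by (simp add: scaleR_diff_right)
  moreover have "r \<in> interior K" using int r by fastforce
  ultimately have "\<forall>\<^sub>F n in sequentially. inverse (norm (c n)) *\<^sub>R (c n - p) \<in> interior K"
    using topological_tendstoD open_interior by blast
  then obtain n where n: "inverse (norm (c n)) *\<^sub>R (c n - p) \<in> K"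
    using interior_subset by (force simp: eventually_sequentially)
  then have "norm (c n) *\<^sub>R (inverse (norm (c n)) *\<^sub>R (c n - p)) \<in> K"
    using norm_ge_zero by (rule convex_cone_scaleR[OF K, rotated])
  moreover have "norm (c n) \<noteq> 0" using c(2)[of n] by auto
  ultimately show False using c(1)[of n] by simp
qed

theorem theorem5p6:
  fixes A0 :: "real^'m^'m" and A :: "'n::finite \<Rightarrow> real^'m^'m"
    and C P :: "(real^'n) set" and \<epsilon> \<delta> :: real
  assumes "\<epsilon> > 0" and "\<delta> > 0"
    and "transpose A0 = A0" and "\<And>i. transpose (A i) = A i"
    and "C = spectrahedron A0 A"
    and "\<not> bounded C" and "closed C" and "convex C" and "line_free C" and "interior C \<noteq> {}"
    and "algorithm A0 A \<epsilon> \<delta> P"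
  shows "(\<exists>V D. V_representation V D P) \<and>
         (\<forall>V D. V_representation V D P \<longrightarrow>
            eps_delta_approx \<epsilon> \<delta> (convex hull V + convex_cone hull D) C)"
proof -
  define w where "w = (1 / norm (trace_vec A)) *\<^sub>R trace_vec A"
  define R where "R = {x. psd (lin_pencil A x)}"
  define M where "M = R \<inter> {x. w \<bullet> x = - (1 + \<delta>)}"
  have C: "C \<noteq> {}" using assms(10) interior_subset by blast
  have R: "recession_cone C = R"
    using C recession_cone_spectrahedron unfolding R_def assms(5) by blast
  obtain VM K \<mu> VP where
    VM: "(\<exists>p. M = {p}) \<and> VM = M \<or>
      (\<exists>E. ambient_frame (affine hull M) E \<and> cutting_scheme (affine hull M) E 0 A (\<delta> / 2) VM)"
    and K: "K = convex_cone hull (ext (convex hull VM + l1_ball (\<delta> / 2)))"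
    and \<mu>: "\<mu> = (INF y\<in>convex hull (ext (C + K)). w \<bullet> y)"
    and VP: "cutting_scheme UNIV Basis (bordered A0 (- (\<mu> - \<epsilon>))) (\<lambda>i. bordered (A i) (w $ i)) \<epsilon> VP"
    and P: "P = convex hull VP + K"
    using assms(11) unfolding algorithm_def M_def w_def R[symmetric] assms(5) by blast
  \<comment> \<open>The existence of a run is what guarantees this: an ambient frame requires a
    nonempty affine hull.\<close>
  have "M \<noteq> {}"
    using VM by (auto simp: ambient_frame_def)
  \<comment> \<open>Otherwise \<open>w = 0\<close>, and the equation defining \<open>M\<close> would
    read \<open>0 = - (1 + \<delta>)\<close>.\<close>
  then have "trace_vec A \<noteq> 0"
    using assms(2) by (auto simp: M_def w_def)
  then have nw: "norm w = 1" by (simp add: w_def)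
  have Rneg: "w \<bullet> r < 0" if "r \<in> R" "r \<noteq> 0" for r
    using recession_direction_neg[of A0 A r] that assms(9) C \<open>trace_vec A \<noteq> 0\<close>
    by (simp add: w_def R_def assms(5) divide_neg_pos)
  have Rcone: "s *\<^sub>R r \<in> R" if "r \<in> R" "0 \<le> s" for r s
    using that by (simp add: R_def linear_cmul[OF linear_lin_pencil] psd_scaleR)
  have B: "polytope (convex hull VM)" "M \<subseteq> convex hull VM" "convex hull VM \<subseteq> {x. w \<bullet> x = - (1 + \<delta>)}"
    "\<And>x. x \<in> convex hull VM \<Longrightarrow> \<exists>y\<in>M. norm (x - y) \<le> \<delta> / 2"
  proof -
    have aff: "affine hull M \<subseteq> {x. w \<bullet> x = - (1 + \<delta>)}"
      by (intro hull_minimal affine_hyperplane) (auto simp: M_def)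
    have M: "affine hull M \<inter> spectrahedron 0 A = M"
      using aff hull_subset[of M affine]
      by (auto simp: M_def R_def spectrahedron_def pencil_homogeneous)
    have 0: "transpose (0 :: real^'m^'m) = 0" by (simp add: transpose_def vec_eq_iff)
    consider p where "M = {p}" "VM = M"
      | E where "ambient_frame (affine hull M) E" "cutting_scheme (affine hull M) E 0 A (\<delta> / 2) VM"
      using VM by blast
    then have "polytope (convex hull VM) \<and> M \<subseteq> convex hull VM \<and> convex hull VM \<subseteq> {x. w \<bullet> x = - (1 + \<delta>)} \<and>
      (\<forall>x\<in>convex hull VM. \<exists>y\<in>M. norm (x - y) \<le> \<delta> / 2)"
    proof cases
      case 1
      then show ?thesis using assms(2) by (auto simp: polytope_sing M_def)
    next
      case 2
      then show ?thesis
        using cutting_scheme_approximation[OF 0 assms(4) 2] assms(2) aff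
        unfolding M by (auto simp: polytope_convex_hull)
    qed
    then show "polytope (convex hull VM)" "M \<subseteq> convex hull VM" "convex hull VM \<subseteq> {x. w \<bullet> x = - (1 + \<delta>)}"
      "\<And>x. x \<in> convex hull VM \<Longrightarrow> \<exists>y\<in>M. norm (x - y) \<le> \<delta> / 2" by blast+
  qed
  note K_props = outer_cone[OF assms(2) nw Rcone Rneg M_def \<open>M \<noteq> {}\<close> B K]
  have trunc: "bounded (C \<inter> {x. L \<le> w \<bullet> x})" for L
    unfolding assms(5) using Rneg by (intro spectrahedron_truncations_bounded) (auto simp: R_def)
  have outside: "bounded {y \<in> C. y - p \<notin> K}" for p
    unfolding assms(5) using K_props(2,5) by (intro spectrahedron_outside_cone_bounded) (auto simp: R_def)
  obtain c where c: "c \<in> C" using C by blast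
  have extC: "ext (C + K) \<subseteq> C" using K_props(2) by (rule ext_set_plus_cone_subset)
  \<comment> \<open>Boundedness of these extreme points is needed before the real infimum \<mu> can
    serve as a lower bound.\<close>
  have "ext (C + K) \<subseteq> insert c {y \<in> C. y - c \<notin> K}"
  proof
    fix x assume x: "x \<in> ext (C + K)"
    have "x = c" if "x - c \<in> K"
      using ext_set_plus_cone[of c "x - c" C K] that x c K_props(2) by simp
    then show "x \<in> insert c {y \<in> C. y - c \<notin> K}" using x extC by blast
  qed
  then have "bounded (convex hull (ext (C + K)))"
    using outside by (intro bounded_convex_hull) (meson bounded_insert bounded_subset)
  then have "bdd_below ((\<bullet>) w ` (convex hull (ext (C + K))))"
    by (intro bounded_imp_bdd_below bounded_linear_image bounded_linear_inner_right)
  then have \<mu>_le: "\<mu> \<le> w \<bullet> y" if "y \<in> convex hull (ext (C + K))" for y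
    unfolding \<mu> using that by (intro cINF_lower)
  have spec: "UNIV \<inter> spectrahedron (bordered A0 (- (\<mu> - \<epsilon>))) (\<lambda>i. bordered (A i) (w $ i)) =
      C \<inter> {x. \<mu> - \<epsilon> \<le> w \<bullet> x}"
    unfolding assms(5) spectrahedron_def pencil_bordered psd_bordered by auto
  note VP_props = cutting_scheme_approximation[OF transpose_bordered[OF assms(3)]
      transpose_bordered[OF assms(4)] ambient_frame_UNIV VP less_imp_le[OF assms(1)], unfolded spec]
  have VPne: "convex hull VP \<noteq> {}" "bounded (convex hull VP)"
    using VP_props(1-3) by (auto simp: finite_imp_bounded_convex_hull)
  have recP: "recession_cone P = K"
    unfolding P using VPne(2,1) K_props(2,3) by (rule recession_cone_set_plus)
  have "V_representation VP (ext (convex hull VM + l1_ball (\<delta> / 2))) P"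
    unfolding V_representation_def using P K VP_props(1) K_props(1) by simp
  moreover have "C \<subseteq> P"
  proof
    fix x assume x: "x \<in> C"
    obtain y where y: "y \<in> C" "x - y \<in> K" "y \<in> convex hull (ext (C + K))"
      using minimal_point_in_hull[OF assms(8,7) K_props(2,3,4) trunc c outside x] by blast
    have "y \<in> convex hull VP"
      using VP_props(3) y(1) \<mu>_le[OF y(3)] assms(1) by auto
    then have "y + (x - y) \<in> P" unfolding P using y(2) by (rule set_plus_intro)
    then show "x \<in> P" by simp
  qed
  moreover have "line_free P"
  proof -
    have "k = 0" if "k \<in> K" "- k \<in> K" for k
      using K_props(4)[of k] K_props(4)[of "- k"] that by force
    then show ?thesis
      unfolding line_free_def recP using convex_cone_contains_0[OF K_props(2)] by force
  qed
  moreover have "excess (ext P) C \<le> ereal \<epsilon>"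
    unfolding excess_def
  proof (rule SUP_least)
    fix x assume "x \<in> ext P"
    then have "x \<in> convex hull VP"
      unfolding P using ext_set_plus_cone_subset[OF K_props(2)] by blast
    then obtain y where "y \<in> C" "norm (x - y) \<le> \<epsilon>" using VP_props(5) by blast
    then show "(INF y\<in>C. ereal (norm (x - y))) \<le> ereal \<epsilon>"
      by (intro INF_lower2[of y]) auto
  qed
  moreover have "cone_dist (recession_cone P) (recession_cone C) \<le> ereal \<delta>"
    unfolding recP R by (rule K_props(7))
  ultimately have "V_representation VP (ext (convex hull VM + l1_ball (\<delta> / 2))) P" "eps_delta_approx \<epsilon> \<delta> P C"
    unfolding eps_delta_approx_def by blast+
  \<comment> \<open>Every V-representation of \<open>P\<close> describes the same set, so the
    approximation property of \<open>P\<close> covers all of them.\<close>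
  then show ?thesis
    unfolding V_representation_def by blast
qed

end
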